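(* Let $X,U$ be Banach spaces, let $A:D(A)\to X$ generate a $C_0$-semigroup on $X$, and let $f:X\times U\to X$ satisfy $f(0,0)=0$, be Lipschitz continuous on bounded subsets of $X$ uniformly with respect to the second argument, and be such that $f(x,\cdot)$ is continuous for every $x\in X$. Consider the system $\dot x(t)=Ax(t)+f(x(t),u(t))$. If there exists an iISS Lyapunov function for this system, then the system is iISS. If there exists an ISS Lyapunov function for this system, then the system is ISS.
   Context: $\mathbb{R}_+=[0,\infty)$. Admissible inputs are $u\in U_c=C_b(\mathbb{R}_+,U)$, the bounded continuous functions $\mathbb{R}_+\to U$ with the supremum norm $\|\cdot\|_{U_c}$. Solutions are mild solutions: continuous $x$ with $x(t)=T(t)x(0)+\int_0^tT(t-s)f(x(s),u(s))\,ds$, where $\{T(t)\}_{t\ge0}$ is the $C_0$-semigroup generated by $A$; $\phi(t,\phi_0,u)$ is the state at time $t$ of the solution with initial condition $\phi_0$ at $t=0$ and input $u$. $f$ is Lipschitz continuous on bounded subsets of $X$, uniformly w.r.t. the second argument, if for every $w>0$ there is $L(w)>0$ such that $\|f(y,v)-f(x,v)\|_X\le L(w)\|y-x\|_X$ for all $x,y$ with $\|x\|_X\le w$, $\|y\|_X\le w$ and all $v\in U$. Comparison functions: $\mathcal{P}$ = continuous $\gamma:\mathbb{R}_+\to\mathbb{R}_+$ with $\gamma(0)=0$ and $\gamma(r)>0$ for $r>0$; $\mathcal{K}$ = strictly increasing functions in $\mathcal{P}$; $\mathcal{K}_\infty$ = unbounded functions in $\mathcal{K}$; $\mathcal{L}$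 = continuous strictly decreasing $\gamma:\mathbb{R}_+\to\mathbb{R}_+$ with $\lim_{t\to\infty}\gamma(t)=0$; $\mathcal{KL}$ = continuous $\beta:\mathbb{R}_+\times\mathbb{R}_+\to\mathbb{R}_+$ with $\beta(\cdot,t)\in\mathcal{K}$ for all $t\ge0$ and $\beta(r,\cdot)\in\mathcal{L}$ for all $r>0$. iISS: there are $\theta\in\mathcal{K}_\infty$, $\mu\in\mathcal{K}$, $\beta\in\mathcal{KL}$ such that $\|\phi(t,\phi_0,u)\|_X\le\beta(\|\phi_0\|_X,t)+\theta\left(\int_0^t\mu(\|u(s)\|_U)\,ds\right)$ for all $\phi_0\in X$, $u\in U_c$, $t\ge0$. ISS: there are $\beta\in\mathcal{KL}$, $\gamma\in\mathcal{K}$ such that $\|\phi(t,\phi_0,u)\|_X\le\beta(\|\phi_0\|_X,t)+\gamma(\|u\|_{U_c})$ for all $\phi_0\in X$, $u\in U_c$, $t\ge0$. (In both cases solutions are in particular required to exist for all $t\ge 0$.) iISS Lyapunov function: a continuous $V:X\to\mathbb{R}_+$ for which there exist $\psi_1,\psi_2\in\mathcal{K}_\infty$, $\alpha\in\mathcal{P}$, $\sigma\in\mathcal{K}$ such that $\psi_1(\|x\|_X)\le V(x)\le\psi_2(\|x\|_X)$ for all $x\in X$ and $\dot V_u(x)\le-\alpha(\|x\|_X)+\sigma(\|u(0)\|_U)$ for all $x\in X$ and $u\in U_c$, where $\dot V_u(x)=\limsup_{t\to+0}\frac1t\bigl(V(\phi(t,x,u))-V(x)\bigr)$. If furthermore $\lim_{\tau\to\infty}\alpha(\tau)=\infty$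 or $\liminf_{\tau\to\infty}\alpha(\tau)\ge\lim_{\tau\to\infty}\sigma(\tau)$, then $V$ is called an ISS Lyapunov function. *)

theory Defs
  imports "HOL-Analysis.Analysis"
begin

text \<open>
  Functions on the half-line \<open>[0,\<infinity>)\<close> are represented by functions on \<^typ>\<open>real\<close>;
  every condition refers to nonnegative arguments only, and values at negative
  arguments are irrelevant.
\<close>

subsection \<open>Strongly continuous semigroups\<close>

definition C0_semigroup :: "(real \<Rightarrow> 'x \<Rightarrow>\<^sub>L 'x::banach) \<Rightarrow> bool" where
  "C0_semigroup T \<longleftrightarrow>
     T 0 = id_blinfun \<and>
     (\<forall>s\<ge>0. \<forall>t\<ge>0. T (s + t) = T s o\<^sub>L T t) \<and>
     (\<forall>x. ((\<lambda>t. blinfun_apply (T t) x) \<longlongrightarrow> x) (at_right 0))"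

text \<open>The unbounded operator \<open>A\<close> has domain \<open>D\<close>; values of \<open>A\<close> outside \<open>D\<close> are irrelevant.\<close>

definition generates ::
  "'x set \<Rightarrow> ('x \<Rightarrow> 'x) \<Rightarrow> (real \<Rightarrow> 'x \<Rightarrow>\<^sub>L 'x::banach) \<Rightarrow> bool" where
  "generates D A T \<longleftrightarrow>
     C0_semigroup T \<and>
     D = {x. \<exists>y. ((\<lambda>h. (blinfun_apply (T h) x - x) /\<^sub>R h) \<longlongrightarrow> y) (at_right 0)} \<and>
     (\<forall>x\<in>D. ((\<lambda>h. (blinfun_apply (T h) x - x) /\<^sub>R h) \<longlongrightarrow> A x) (at_right 0))"

subsection \<open>Inputs and solutions\<close>

definition inputs :: "(real \<Rightarrow> 'u::banach) set" where
  "inputs = {u. continuous_on {0..} u \<and> bounded (u ` {0..})}"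

definition input_norm :: "(real \<Rightarrow> 'u::banach) \<Rightarrow> real" where
  "input_norm u = (SUP t\<in>{0..}. norm (u t))"

definition lipschitz_on_bounded_sets :: "('x::banach \<Rightarrow> 'u::banach \<Rightarrow> 'x) \<Rightarrow> bool" where
  "lipschitz_on_bounded_sets f \<longleftrightarrow>
     (\<forall>w>0. \<exists>L>0. \<forall>x y v. norm x \<le> w \<longrightarrow> norm y \<le> w \<longrightarrow>
        norm (f y v - f x v) \<le> L * norm (y - x))"

text \<open>
  \<open>J\<close> is a time interval with left end point 0. If \<open>f\<close> is locally Lipschitz
  as above and continuous in its second argument, then the integrand is continuous,
  so the integral is a genuine (Riemann) integral.
\<close>

definition mild_solution ::
  "(real \<Rightarrow> 'x \<Rightarrow>\<^sub>L 'x) \<Rightarrow> ('x \<Rightarrow> 'u \<Rightarrow> 'x) \<Rightarrow> (real \<Rightarrow> 'u::banach) \<Rightarrow> real set \<Rightarrow>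
    (real \<Rightarrow> 'x::banach) \<Rightarrow> bool" where
  "mild_solution T f u J x \<longleftrightarrow>
     continuous_on J x \<and>
     (\<forall>t\<in>J. x t = blinfun_apply (T t) (x 0)
         + integral {0..t} (\<lambda>s. blinfun_apply (T (t - s)) (f (x s) (u s))))"

text \<open>
  The state at time \<open>t\<close>. It is meaningful whenever a mild solution on \<open>[0,t]\<close> exists
  (under the Lipschitz condition it is then unique); notions which need existence of
  solutions for all times have to demand it separately.
\<close>

definition flow ::
  "(real \<Rightarrow> 'x \<Rightarrow>\<^sub>L 'x) \<Rightarrow> ('x \<Rightarrow> 'u \<Rightarrow> 'x) \<Rightarrow> real \<Rightarrow> 'x::banach \<Rightarrow> (real \<Rightarrow> 'u::banach) \<Rightarrow> 'x"
  where
  "flow T f t x0 u = (THE y. \<exists>x. mild_solution T f u {0..t} x \<and> x 0 = x0 \<and> x t = y)"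

definition forward_complete ::
  "(real \<Rightarrow> 'x \<Rightarrow>\<^sub>L 'x::banach) \<Rightarrow> ('x \<Rightarrow> 'u::banach \<Rightarrow> 'x) \<Rightarrow> bool" where
  "forward_complete T f \<longleftrightarrow>
     (\<forall>x0. \<forall>u\<in>inputs. \<exists>x. mild_solution T f u {0..} x \<and> x 0 = x0)"

subsection \<open>Comparison functions\<close>

definition class_P :: "(real \<Rightarrow> real) set" where
  "class_P = {\<gamma>. continuous_on {0..} \<gamma> \<and> \<gamma> 0 = 0 \<and> (\<forall>r>0. \<gamma> r > 0)}"

definition class_K :: "(real \<Rightarrow> real) set" where
  "class_K = {\<gamma> \<in> class_P. strict_mono_on {0..} \<gamma>}"

definition class_K_inf :: "(real \<Rightarrow> real) set" where
  "class_K_inf = {\<gamma> \<in> class_K. \<not> bounded (\<gamma> ` {0..})}"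

definition class_L :: "(real \<Rightarrow> real) set" where
  "class_L = {\<gamma>. continuous_on {0..} \<gamma> \<and> (\<forall>t\<ge>0. \<gamma> t \<ge> 0) \<and>
     (\<forall>s t. 0 \<le> s \<longrightarrow> s < t \<longrightarrow> \<gamma> t < \<gamma> s) \<and> (\<gamma> \<longlongrightarrow> 0) at_top}"

definition class_KL :: "(real \<Rightarrow> real \<Rightarrow> real) set" where
  "class_KL = {\<beta>. continuous_on ({0..} \<times> {0..}) (\<lambda>(r, t). \<beta> r t) \<and>
     (\<forall>t\<ge>0. (\<lambda>r. \<beta> r t) \<in> class_K) \<and> (\<forall>r>0. (\<lambda>t. \<beta> r t) \<in> class_L)}"

subsection \<open>Stability\<close>

definition iISS ::
  "(real \<Rightarrow> 'x \<Rightarrow>\<^sub>L 'x::banach) \<Rightarrow> ('x \<Rightarrow> 'u::banach \<Rightarrow> 'x) \<Rightarrow> bool" where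
  "iISS T f \<longleftrightarrow>
     forward_complete T f \<and>
     (\<exists>\<theta>\<in>class_K_inf. \<exists>\<mu>\<in>class_K. \<exists>\<beta>\<in>class_KL. \<forall>x0. \<forall>u\<in>inputs. \<forall>t\<ge>0.
        norm (flow T f t x0 u) \<le> \<beta> (norm x0) t + \<theta> (integral {0..t} (\<lambda>s. \<mu> (norm (u s)))))"

definition ISS ::
  "(real \<Rightarrow> 'x \<Rightarrow>\<^sub>L 'x::banach) \<Rightarrow> ('x \<Rightarrow> 'u::banach \<Rightarrow> 'x) \<Rightarrow> bool" where
  "ISS T f \<longleftrightarrow>
     forward_complete T f \<and>
     (\<exists>\<beta>\<in>class_KL. \<exists>\<gamma>\<in>class_K. \<forall>x0. \<forall>u\<in>inputs. \<forall>t\<ge>0.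
        norm (flow T f t x0 u) \<le> \<beta> (norm x0) t + \<gamma> (input_norm u))"

subsection \<open>Lyapunov functions\<close>

text \<open>The upper right Dini derivative along trajectories may be infinite.\<close>

definition Lie_derivative ::
  "(real \<Rightarrow> 'x \<Rightarrow>\<^sub>L 'x) \<Rightarrow> ('x \<Rightarrow> 'u \<Rightarrow> 'x) \<Rightarrow> ('x \<Rightarrow> real) \<Rightarrow> (real \<Rightarrow> 'u::banach) \<Rightarrow>
    'x::banach \<Rightarrow> ereal" where
  "Lie_derivative T f V u x =
     Limsup (at_right 0) (\<lambda>t. ereal (1 / t * (V (flow T f t x u) - V x)))"

definition dissipates ::
  "(real \<Rightarrow> 'x \<Rightarrow>\<^sub>L 'x) \<Rightarrow> ('x \<Rightarrow> 'u::banach \<Rightarrow> 'x) \<Rightarrow> ('x::banach \<Rightarrow> real) \<Rightarrow>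
    (real \<Rightarrow> real) \<Rightarrow> (real \<Rightarrow> real) \<Rightarrow> bool" where
  "dissipates T f V \<alpha> \<sigma> \<longleftrightarrow>
     continuous_on UNIV V \<and> (\<forall>x. V x \<ge> 0) \<and>
     (\<exists>\<psi>1\<in>class_K_inf. \<exists>\<psi>2\<in>class_K_inf. \<forall>x. \<psi>1 (norm x) \<le> V x \<and> V x \<le> \<psi>2 (norm x)) \<and>
     (\<forall>x. \<forall>u\<in>inputs. Lie_derivative T f V u x \<le> ereal (- \<alpha> (norm x) + \<sigma> (norm (u 0))))"

definition iISS_Lyapunov_function ::
  "(real \<Rightarrow> 'x \<Rightarrow>\<^sub>L 'x) \<Rightarrow> ('x \<Rightarrow> 'u::banach \<Rightarrow> 'x) \<Rightarrow> ('x::banach \<Rightarrow> real) \<Rightarrow> bool" where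
  "iISS_Lyapunov_function T f V \<longleftrightarrow> (\<exists>\<alpha>\<in>class_P. \<exists>\<sigma>\<in>class_K. dissipates T f V \<alpha> \<sigma>)"

text \<open>
  A function of class K is monotone, so its limit at infinity exists in the extended reals.
\<close>

definition ISS_Lyapunov_function ::
  "(real \<Rightarrow> 'x \<Rightarrow>\<^sub>L 'x) \<Rightarrow> ('x \<Rightarrow> 'u::banach \<Rightarrow> 'x) \<Rightarrow> ('x::banach \<Rightarrow> real) \<Rightarrow> bool" where
  "ISS_Lyapunov_function T f V \<longleftrightarrow>
     (\<exists>\<alpha>\<in>class_P. \<exists>\<sigma>\<in>class_K. dissipates T f V \<alpha> \<sigma> \<and>
        (filterlim \<alpha> at_top at_top \<or>
         Liminf at_top (\<lambda>\<tau>. ereal (\<alpha> \<tau>)) \<ge> Lim at_top (\<lambda>\<tau>. ereal (\<sigma> \<tau>))))"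

end

theory Submission
  imports Defs
begin

text \<open>
  Along a mild solution \<open>x\<close> the Dini inequality for \<open>V\<close> integrates to
  \<open>V (x b) + \<integral>\<^sub>a\<^sup>b \<alpha>(|x|) \<le> V (x a) + \<integral>\<^sub>a\<^sup>b \<sigma>(|u|)\<close>.
  Since \<open>V\<close> is coercive, this excludes blow-up; global solutions are obtained from the equation
  with \<open>f\<close> truncated outside a ball which the a priori bound does not allow solutions to leave.

  Let \<open>S(t) = \<integral>\<^sub>0\<^sup>t \<sigma>(|u|)\<close>. For iISS, either \<open>V (x t) \<le> 2 S(t)\<close>, or \<open>a = V (x t) - S(t)\<close>
  exceeds \<open>S(t)\<close>, and then \<open>a \<le> V (x s) \<le> 2 V (x 0)\<close> on \<open>[0,t]\<close>, so that \<open>\<alpha>(|x|)\<close> is bounded below on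
  \<open>[0,t]\<close> in terms of \<open>a\<close> and \<open>V (x 0)\<close>, which bounds \<open>a\<close> by a function of class KL.
  For ISS, the growth condition gives a gain \<open>\<eta>\<close> of class K-infinity with \<open>\<sigma>(\<eta>(r)) < \<alpha>(r)\<close>; as long as
  \<open>|u| \<le> \<eta>(|x|)\<close>, \<open>V\<close> decreases at rate \<open>\<alpha> - \<sigma> \<circ> \<eta>\<close>, and the same decay estimate applies.
\<close>

subsection \<open>Comparison functions\<close>

text \<open>\<alpha> is only positive definite: it need not be monotone and may tend to 0 at
  infinity. A lower bound on \<alpha>(|x|) along a trajectory therefore needs |x| bounded from both
  sides. This is why the decay estimate takes a two-sided bound and why \<alpha> is first minorized
  by an increasing times a decreasing function. For the same reason, and because \<sigma> may be
  bounded, the inverse of \<sigma> applied to a fraction of \<alpha> cannot serve as the ISS gain;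
  an infimal convolution replaces it.

  The two growth conditions of an ISS Lyapunov function enter only through a common consequence:
  every value \<sigma>(c) is strictly exceeded by \<alpha> at all large arguments. In the second
  condition the strictness comes from \<sigma> being strictly increasing, hence never reaching its
  limit.

  V is merely continuous, and its Dini derivative is prescribed only at time 0 of a solution.
  Passing to later times relies on uniqueness and on restarting solutions with shifted inputs; the
  resulting pointwise inequality is integrated by a last-time argument.\<close>

lemma class_KD:
  assumes "\<gamma> \<in> class_K"
  shows "continuous_on {0..} \<gamma>" "\<gamma> 0 = 0" "strict_mono_on {0..} \<gamma>"
  using assms by (auto simp: class_K_def class_P_def)

lemma class_KI:
  assumes "continuous_on {0..} \<gamma>" "\<gamma> 0 = 0"
    and "\<And>r s. 0 \<le> r \<Longrightarrow> r < s \<Longrightarrow> \<gamma> r < \<gamma> s"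
  shows "\<gamma> \<in> class_K"
  using assms(1,2) assms(3)[of 0] assms(3)
  by (auto simp: class_K_def class_P_def strict_mono_on_def)

lemma class_K_less:
  assumes "\<gamma> \<in> class_K" "0 \<le> r" "r < s" shows "\<gamma> r < \<gamma> s"
  using class_KD(3)[OF assms(1)] assms(2,3) by (auto simp: strict_mono_on_def)

lemma class_K_mono:
  assumes "\<gamma> \<in> class_K" "0 \<le> r" "r \<le> s" shows "\<gamma> r \<le> \<gamma> s"
  using class_K_less[OF assms(1,2), of s] assms(3) by (cases "r = s") auto

lemma class_K_nonneg: "\<gamma> \<in> class_K \<Longrightarrow> 0 \<le> r \<Longrightarrow> 0 \<le> \<gamma> r"
  using class_K_mono[of \<gamma> 0 r] class_KD(2)[of \<gamma>] by simp

lemma class_K_pos: "\<gamma> \<in> class_K \<Longrightarrow> 0 < r \<Longrightarrow> 0 < \<gamma> r"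
  using class_K_less[of \<gamma> 0 r] class_KD(2)[of \<gamma>] by simp

lemma class_K_le_cancel:
  assumes "\<gamma> \<in> class_K" "0 \<le> s" "\<gamma> r \<le> \<gamma> s" shows "r \<le> s"
  using class_K_less[OF assms(1,2), of r] assms(3) by force

lemma class_K_compose:
  assumes "\<gamma> \<in> class_K" "\<delta> \<in> class_K" shows "(\<lambda>r. \<gamma> (\<delta> r)) \<in> class_K"
proof (rule class_KI)
  show "continuous_on {0..} (\<lambda>r. \<gamma> (\<delta> r))"
    by (rule continuous_on_compose2[OF class_KD(1)[OF assms(1)] class_KD(1)[OF assms(2)]])
      (use class_K_nonneg[OF assms(2)] in auto)
qed (use class_KD(2)[OF assms(1)] class_KD(2)[OF assms(2)] class_K_less[OF assms(1)]
    class_K_less[OF assms(2)] class_K_nonneg[OF assms(2)] in auto)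

lemma class_K_scale: "\<gamma> \<in> class_K \<Longrightarrow> c > 0 \<Longrightarrow> (\<lambda>r. \<gamma> (c * r)) \<in> class_K"
  by (rule class_K_compose) (auto intro!: class_KI continuous_intros)

section \<open>Unbounded functions of class K and their inverses\<close>

lemma class_K_inf_imp_K: "\<gamma> \<in> class_K_inf \<Longrightarrow> \<gamma> \<in> class_K"
  by (simp add: class_K_inf_def)

lemma class_K_inf_unbounded:
  assumes "\<gamma> \<in> class_K_inf" obtains r where "0 \<le> r" "N < \<gamma> r"
proof -
  have "\<gamma> \<in> class_K" and nb: "\<not> bounded (\<gamma> ` {0..})"
    using assms by (auto simp: class_K_inf_def)
  have "\<exists>r\<ge>0. N < \<gamma> r"
  proof (rule ccontr)
    assume "\<not> ?thesis"
    then have "\<forall>r\<in>{0..}. norm (\<gamma> r) \<le> N"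
      using class_K_nonneg[OF \<open>\<gamma> \<in> class_K\<close>] by force
    then show False using nb by (auto simp: bounded_iff)
  qed
  then show ?thesis using that by blast
qed

lemma class_K_infI:
  assumes "\<gamma> \<in> class_K" "\<And>N. \<exists>r\<ge>0. N < \<gamma> r" shows "\<gamma> \<in> class_K_inf"
proof -
  have "\<not> bounded (\<gamma> ` {0..})"
  proof
    assume "bounded (\<gamma> ` {0..})"
    then obtain B where "\<forall>r\<ge>0. norm (\<gamma> r) \<le> B" by (auto simp: bounded_iff)
    then show False using assms(2)[of B] by force
  qed
  then show ?thesis using assms(1) by (simp add: class_K_inf_def)
qed

text \<open>By the intermediate value theorem an unbounded function of class K maps the half-line
  onto itself, and a continuous injection of an interval is a homeomorphism onto its image.
  Monotonicity and unboundedness then pass to the inverse.\<close>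

lemma class_K_inf_inverse:
  assumes "\<gamma> \<in> class_K_inf"
  obtains \<kappa> where "\<kappa> \<in> class_K_inf"
    "\<And>r. 0 \<le> r \<Longrightarrow> \<kappa> (\<gamma> r) = r" "\<And>r. 0 \<le> r \<Longrightarrow> \<gamma> (\<kappa> r) = r"
proof -
  note K = class_K_inf_imp_K[OF assms]
  note c = class_KD(1)[OF K]
  have inj: "inj_on \<gamma> {0..}"
    by (rule strict_mono_on_imp_inj_on[OF class_KD(3)[OF K]])
  have im: "\<gamma> ` {0..} = {0..}"
  proof
    show "\<gamma> ` {0..} \<subseteq> {0..}" using class_K_nonneg[OF K] by auto
    show "{0..} \<subseteq> \<gamma> ` {0..}"
    proof
      fix y :: real assume y: "y \<in> {0..}"
      obtain r where r: "0 \<le> r" "y < \<gamma> r" using class_K_inf_unbounded[OF assms] .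
      have "\<exists>x\<ge>0. x \<le> r \<and> \<gamma> x = y"
        by (rule IVT'[OF _ _ _ continuous_on_subset[OF c]]) (use r y class_KD(2)[OF K] in auto)
      then show "y \<in> \<gamma> ` {0..}" by auto
    qed
  qed
  have "path_connected {0::real..}" by (simp add: convex_imp_path_connected)
  then obtain \<kappa> where "homeomorphism {0..} (\<gamma> ` {0..}) \<gamma> \<kappa>"
    using injective_into_1d_eq_homeomorphism[OF c] inj by blast
  then have h: "continuous_on {0..} \<kappa>" "\<kappa> ` {0..} = {0..}"
    "\<And>r. 0 \<le> r \<Longrightarrow> \<kappa> (\<gamma> r) = r" "\<And>r. 0 \<le> r \<Longrightarrow> \<gamma> (\<kappa> r) = r"
    by (auto simp: homeomorphism_def im)
  have nn: "\<kappa> r \<ge> 0" if "0 \<le> r" for r using h(2) that by auto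
  have "\<kappa> \<in> class_K"
  proof (rule class_KI[OF h(1)])
    show "\<kappa> 0 = 0" using h(3)[of 0] class_KD(2)[OF K] by simp
    fix r s :: real assume rs: "0 \<le> r" "r < s"
    show "\<kappa> r < \<kappa> s"
    proof (rule ccontr)
      assume "\<not> ?thesis"
      then have "\<gamma> (\<kappa> s) \<le> \<gamma> (\<kappa> r)" using class_K_mono[OF K] nn rs by auto
      then show False using h(4) rs by simp
    qed
  qed
  moreover have "\<exists>r\<ge>0. N < \<kappa> r" for N
    using h(3)[of "\<bar>N\<bar> + 1"] class_K_nonneg[OF K, of "\<bar>N\<bar> + 1"]
    by (intro exI[of _ "\<gamma> (\<bar>N\<bar> + 1)"]) auto
  ultimately show ?thesis using that h class_K_infI by blast
qed

text \<open>Weak triangle inequality: a sum is at most twice its larger term. It separates the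
  contribution of the initial state from that of the input.\<close>

lemma class_K_le_double:
  assumes "\<gamma> \<in> class_K" "0 \<le> p" "0 \<le> q"
  shows "\<gamma> (p + q) \<le> \<gamma> (2 * p) + \<gamma> (2 * q)"
proof (cases "p \<le> q")
  case True
  then show ?thesis
    using class_K_mono[OF assms(1), of "p + q" "2 * q"] class_K_nonneg[OF assms(1), of "2 * p"] assms(2,3)
    by linarith
next
  case False
  then show ?thesis
    using class_K_mono[OF assms(1), of "p + q" "2 * p"] class_K_nonneg[OF assms(1), of "2 * q"] assms(2,3)
    by linarith
qed

text \<open>Infimal convolutions are only nondecreasing; multiplying by a factor of class K restores
  strict growth.\<close>

lemma class_K_mult:
  assumes "p \<in> class_K" "continuous_on {0..} q" "\<And>r. 0 < r \<Longrightarrow> 0 < q r"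
    and "\<And>r s. 0 \<le> r \<Longrightarrow> r \<le> s \<Longrightarrow> q r \<le> q s"
  shows "(\<lambda>r. p r * q r) \<in> class_K"
proof (rule class_KI)
  show "continuous_on {0..} (\<lambda>r. p r * q r)"
    by (intro continuous_intros class_KD(1) assms)
  show "p 0 * q 0 = 0" using class_KD(2)[OF assms(1)] by simp
  fix r s :: real assume rs: "0 \<le> r" "r < s"
  have "p r * q r \<le> p r * q s"
    using rs assms(4)[of r s] class_K_nonneg[OF assms(1)] by (intro mult_left_mono) auto
  also have "\<dots> < p s * q s"
    using rs assms(3)[of s] class_K_less[OF assms(1)] by (intro mult_strict_right_mono) auto
  finally show "p r * q r < p s * q s" .
qed

text \<open>This is the shape in which the decay estimate is solved for the state. Growth in r is
  strict because \<open>N\<close> grows strictly while the denominator does not grow with r; decay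
  in t is strict because \<open>N r\<close> and \<open>d r\<close> are positive for r > 0.\<close>

lemma class_KL_explicit:
  assumes "\<kappa> \<in> class_K" "N \<in> class_K" "continuous_on {0..} d"
    and d: "\<And>r. 0 \<le> r \<Longrightarrow> 0 < d r" "\<And>r s. 0 \<le> r \<Longrightarrow> r \<le> s \<Longrightarrow> d s \<le> d r"
  shows "(\<lambda>r t. \<kappa> (N r / (1 + t * d r))) \<in> class_KL"
proof -
  have den: "1 + t * d r > 0" if "0 \<le> t" "0 \<le> r" for t r
    using d(1)[OF that(2)] that(1) by (simp add: add_pos_nonneg)
  have q0: "N r / (1 + t * d r) \<ge> 0" if "0 \<le> t" "0 \<le> r" for t r
    using den[OF that] class_K_nonneg[OF assms(2) that(2)] by simp
  have cont: "continuous_on ({0..} \<times> {0..}) (\<lambda>(r, t). \<kappa> (N r / (1 + t * d r)))"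
  proof -
    have "continuous_on ({0..} \<times> {0..}) (\<lambda>x. N (fst x))"
      by (rule continuous_on_compose2[OF class_KD(1)[OF assms(2)]]) (auto intro: continuous_intros)
    moreover have "continuous_on ({0..} \<times> {0..}) (\<lambda>x. d (fst x))"
      by (rule continuous_on_compose2[OF assms(3)]) (auto intro: continuous_intros)
    ultimately have "continuous_on ({0..} \<times> {0..}) (\<lambda>x. N (fst x) / (1 + snd x * d (fst x)))"
    proof (intro continuous_intros)
      show "\<forall>x\<in>{0..} \<times> {0..}. 1 + snd x * d (fst x) \<noteq> 0" 
        by (intro ballI order.strict_implies_not_eq[symmetric] den) (auto simp: mem_Times_iff)
    qed
    then show ?thesis unfolding split_def
    proof (rule continuous_on_compose2[OF class_KD(1)[OF assms(1)]])
      show "(\<lambda>x. N (fst x) / (1 + snd x * d (fst x))) ` ({0..} \<times> {0..}) \<subseteq> {0..}"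
        by (intro image_subsetI) (simp add: q0 mem_Times_iff del: zero_le_divide_iff)
    qed
  qed
  have K: "(\<lambda>r. \<kappa> (N r / (1 + t * d r))) \<in> class_K" if t: "0 \<le> t" for t
  proof (rule class_KI)
    show "continuous_on {0..} (\<lambda>r. \<kappa> (N r / (1 + t * d r)))"
    proof -
      have "continuous_on {0..} (\<lambda>r::real. (r, t))" by (intro continuous_intros)
      from continuous_on_compose2[OF cont this] t show ?thesis by auto
    qed
    show "\<kappa> (N 0 / (1 + t * d 0)) = 0"
      using class_KD(2)[OF assms(1)] class_KD(2)[OF assms(2)] by simp
    fix r s :: real assume rs: "0 \<le> r" "r < s"
    have "N r / (1 + t * d r) \<le> N r / (1 + t * d s)"
      using rs t den[of t s] d(2)[of r s] class_K_nonneg[OF assms(2), of r]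
      by (intro divide_left_mono mult_pos_pos den) (auto intro: mult_left_mono)
    also have "\<dots> < N s / (1 + t * d s)"
      using rs t den[of t s] class_K_less[OF assms(2)] by (intro divide_strict_right_mono) auto
    finally show "\<kappa> (N r / (1 + t * d r)) < \<kappa> (N s / (1 + t * d s))"
      by (intro class_K_less[OF assms(1)] q0 t rs)
  qed
  have L: "(\<lambda>t. \<kappa> (N r / (1 + t * d r))) \<in> class_L" if r: "0 < r" for r
    unfolding class_L_def mem_Collect_eq
  proof (intro conjI allI impI)
    show "continuous_on {0..} (\<lambda>t. \<kappa> (N r / (1 + t * d r)))"
    proof -
      have "continuous_on {0..} (\<lambda>t::real. (r, t))" by (intro continuous_intros)
      from continuous_on_compose2[OF cont this] r show ?thesis by (simp add: image_subset_iff)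
    qed
    show "\<kappa> (N r / (1 + t * d r)) \<ge> 0" if "0 \<le> t" for t
      by (intro class_K_nonneg[OF assms(1)] q0) (use r that in auto)
    show "\<kappa> (N r / (1 + t * d r)) < \<kappa> (N r / (1 + s * d r))" if "0 \<le> s" "s < t" for s t
    proof (rule class_K_less[OF assms(1)])
      show "0 \<le> N r / (1 + t * d r)" by (intro q0) (use that r in auto)
      show "N r / (1 + t * d r) < N r / (1 + s * d r)"
        using that r d(1)[of r] class_K_pos[OF assms(2) r] den[of s r] den[of t r]
        by (intro divide_strict_left_mono) auto
    qed
    have "((\<lambda>t. N r / (1 + t * d r)) \<longlongrightarrow> 0) at_top"
      by (rule tendsto_divide_0[OF tendsto_const filterlim_at_top_imp_at_infinity[OF
          filterlim_tendsto_add_at_top[OF tendsto_const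
          filterlim_at_top_mult_tendsto_pos[OF tendsto_const _ filterlim_ident]]]])
        (use d(1)[of r] r in simp)
    moreover have "eventually (\<lambda>t. N r / (1 + t * d r) \<in> {0..}) at_top"
      using eventually_ge_at_top[of 0] by eventually_elim (use q0 r in \<open>simp del: zero_le_divide_iff\<close>)
    ultimately have "((\<lambda>t. \<kappa> (N r / (1 + t * d r))) \<longlongrightarrow> \<kappa> 0) at_top"
      by (intro continuous_on_tendsto_compose[OF class_KD(1)[OF assms(1)]]) simp_all
    then show "((\<lambda>t. \<kappa> (N r / (1 + t * d r))) \<longlongrightarrow> 0) at_top"
      using class_KD(2)[OF assms(1)] by simp
  qed
  show ?thesis using cont K L by (simp add: class_KL_def)
qed

lemma class_KL_nonneg:
  assumes "\<beta> \<in> class_KL" "0 \<le> r" "0 \<le> t" shows "0 \<le> \<beta> r t"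
  using assms class_K_nonneg[of "\<lambda>r. \<beta> r t" r] by (auto simp: class_KL_def)

lemma class_KL_compose:
  assumes "\<beta> \<in> class_KL" "\<kappa> \<in> class_K" "\<psi> \<in> class_K"
  shows "(\<lambda>r t. \<kappa> (\<beta> (\<psi> r) t)) \<in> class_KL"
proof -
  have c: "continuous_on ({0..} \<times> {0..}) (\<lambda>x. \<beta> (fst x) (snd x))"
    and K: "\<And>t. t \<ge> 0 \<Longrightarrow> (\<lambda>r. \<beta> r t) \<in> class_K"
    and L: "\<And>r. r > 0 \<Longrightarrow> (\<lambda>t. \<beta> r t) \<in> class_L"
    using assms(1) by (auto simp: class_KL_def split_def)
  note nn = class_KL_nonneg[OF assms(1) class_K_nonneg[OF assms(3)]]
  have "continuous_on ({0..} \<times> {0..}) (\<lambda>x :: real \<times> real. \<psi> (fst x))"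
    by (rule continuous_on_compose2[OF class_KD(1)[OF assms(3)] continuous_on_fst[OF continuous_on_id]])
      force
  then have p: "continuous_on ({0..} \<times> {0..}) (\<lambda>x :: real \<times> real. (\<psi> (fst x), snd x))"
    by (intro continuous_on_Pair continuous_on_snd continuous_on_id)
  have "continuous_on ({0..} \<times> {0..}) (\<lambda>x. \<beta> (fst (\<psi> (fst x), snd x)) (snd (\<psi> (fst x), snd x)))"
    by (rule continuous_on_compose2[OF c p])
      (auto intro!: class_K_nonneg[OF assms(3)])
  then have "continuous_on ({0..} \<times> {0..}) (\<lambda>x. \<beta> (\<psi> (fst x)) (snd x))"
    by (simp only: fst_conv snd_conv)
  then have "continuous_on ({0..} \<times> {0..}) (\<lambda>x. \<kappa> (\<beta> (\<psi> (fst x)) (snd x)))"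
    by (rule continuous_on_compose2[OF class_KD(1)[OF assms(2)]]) (auto intro!: nn)
  moreover have "(\<lambda>r. \<kappa> (\<beta> (\<psi> r) t)) \<in> class_K" if "t \<ge> 0" for t
    by (rule class_K_compose[OF assms(2) class_K_compose[OF K[OF that] assms(3)]])
  moreover have "(\<lambda>t. \<kappa> (\<beta> (\<psi> r) t)) \<in> class_L" if r: "r > 0" for r
  proof -
    have l: "continuous_on {0..} (\<lambda>t. \<beta> (\<psi> r) t)"
      "\<And>s t. 0 \<le> s \<Longrightarrow> s < t \<Longrightarrow> \<beta> (\<psi> r) t < \<beta> (\<psi> r) s"
      "((\<lambda>t. \<beta> (\<psi> r) t) \<longlongrightarrow> 0) at_top"
      using L[OF class_K_pos[OF assms(3) r]] unfolding class_L_def by blast+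
    have c': "continuous_on {0..} (\<lambda>t. \<kappa> (\<beta> (\<psi> r) t))"
      by (rule continuous_on_compose2[OF class_KD(1)[OF assms(2)] l(1)])
        (use r in \<open>auto intro!: nn\<close>)
    have "((\<lambda>t. \<kappa> (\<beta> (\<psi> r) t)) \<longlongrightarrow> \<kappa> 0) at_top"
    proof (rule continuous_on_tendsto_compose[OF class_KD(1)[OF assms(2)] l(3)])
      show "eventually (\<lambda>t. \<beta> (\<psi> r) t \<in> {0..}) at_top"
        using eventually_ge_at_top[of 0] by eventually_elim (use r in \<open>auto intro!: nn\<close>)
    qed simp
    moreover have "\<kappa> (\<beta> (\<psi> r) t) < \<kappa> (\<beta> (\<psi> r) s)" if "0 \<le> s" "s < t" for s t
      by (rule class_K_less[OF assms(2)]) (use that r in \<open>auto intro!: nn l(2)\<close>)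
    moreover have "\<kappa> (\<beta> (\<psi> r) t) \<ge> 0" if "t \<ge> 0" for t
      by (rule class_K_nonneg[OF assms(2)]) (use r that in \<open>auto intro!: nn\<close>)
    ultimately show ?thesis using c' class_KD(2)[OF assms(2)] by (simp add: class_L_def)
  qed
  ultimately show ?thesis by (simp add: class_KL_def split_def)
qed

text \<open>
  Infimal convolution with \<open>r \<mapsto> max 0 r\<close> of the function, possibly partial and multivalued, whose graph
  is \<open>W\<close>. The result is nondecreasing and 1-Lipschitz, whatever \<open>W\<close> is.
\<close>

definition inf_conv :: "(real \<times> real) set \<Rightarrow> real \<Rightarrow> real" where
  "inf_conv W r = (INF p\<in>W. snd p + max 0 (r - fst p))"

lemma inf_conv_le:
  assumes "W \<subseteq> UNIV \<times> {0..}" "(s, c) \<in> W"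
  shows "inf_conv W r \<le> c + max 0 (r - s)"
proof -
  have "bdd_below ((\<lambda>p. snd p + max 0 (r - fst p)) ` W)"
    by (rule bdd_belowI[of _ 0]) (use assms(1) in force)
  from cINF_lower[OF this assms(2)] show ?thesis by (simp add: inf_conv_def)
qed

lemma inf_conv_ge:
  assumes "W \<noteq> {}" "\<And>s c. (s, c) \<in> W \<Longrightarrow> b \<le> c + max 0 (r - s)"
  shows "b \<le> inf_conv W r"
  unfolding inf_conv_def by (rule cINF_greatest[OF assms(1)]) (use assms(2) in force)

text \<open>A pair lying more than \<epsilon> to the left of r already pays more than \<epsilon>
  through the distance term, so only the remaining pairs have to be checked.\<close>

lemma inf_conv_ge_radius:
  assumes "W \<noteq> {}" "W \<subseteq> UNIV \<times> {0..}"
    and "\<And>s c. (s, c) \<in> W \<Longrightarrow> r - \<epsilon> \<le> s \<Longrightarrow> \<epsilon> \<le> c"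
  shows "\<epsilon> \<le> inf_conv W r"
proof (rule inf_conv_ge[OF assms(1)])
  fix s c assume W: "(s, c) \<in> W"
  show "\<epsilon> \<le> c + max 0 (r - s)"
    using assms(2) assms(3)[OF W] W by (cases "r - \<epsilon> \<le> s") auto
qed

lemma inf_conv_mono:
  assumes "W \<noteq> {}" "W \<subseteq> UNIV \<times> {0..}" "r \<le> r'"
  shows "inf_conv W r \<le> inf_conv W r'"
proof (rule inf_conv_ge[OF assms(1)])
  fix s c assume W: "(s, c) \<in> W"
  show "inf_conv W r \<le> c + max 0 (r' - s)"
    using inf_conv_le[OF assms(2) W, where r = r] assms(3) by (simp add: max_def split: if_splits)
qed

lemma continuous_inf_conv:
  assumes "W \<noteq> {}" "W \<subseteq> UNIV \<times> {0..}"
  shows "continuous_on S (inf_conv W)"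
proof -
  have l: "inf_conv W r \<le> inf_conv W r' + \<bar>r - r'\<bar>" for r r'
  proof -
    have "inf_conv W r - \<bar>r - r'\<bar> \<le> inf_conv W r'"
    proof (rule inf_conv_ge[OF assms(1)])
      fix s c assume W: "(s, c) \<in> W"
      show "inf_conv W r - \<bar>r - r'\<bar> \<le> c + max 0 (r' - s)"
        using inf_conv_le[OF assms(2) W, where r = r] by (auto simp: max_def abs_if split: if_splits)
    qed
    then show ?thesis by simp
  qed
  have "1-lipschitz_on S (inf_conv W)"
  proof (rule lipschitz_onI)
    fix x y
    show "dist (inf_conv W x) (inf_conv W y) \<le> 1 * dist x y"
      using l[of x y] l[of y x] abs_minus_commute[of x y]
      by (simp add: dist_real_def abs_le_iff)
  qed simp
  then show ?thesis by (rule lipschitz_on_continuous_on)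
qed

section \<open>Minorants and gains obtained from positive definite functions\<close>

lemma class_P_bounded_below:
  assumes "\<alpha> \<in> class_P" "0 < a"
  obtains \<delta> where "0 < \<delta>" "\<And>s. a \<le> s \<Longrightarrow> s \<le> b \<Longrightarrow> \<delta> \<le> \<alpha> s"
proof (cases "a \<le> b")
  case True
  have "continuous_on {a..b} \<alpha>"
    by (rule continuous_on_subset[of "{0..}"]) (use assms in \<open>auto simp: class_P_def\<close>)
  then obtain x where "x \<in> {a..b}" "\<And>s. s \<in> {a..b} \<Longrightarrow> \<alpha> x \<le> \<alpha> s"
    using continuous_attains_inf[of "{a..b}" \<alpha>] True by auto
  then show ?thesis using that[of "\<alpha> x"] assms by (auto simp: class_P_def)
qed (use that[of 1] in auto)

lemma class_P_nonneg: "\<alpha> \<in> class_P \<Longrightarrow> 0 \<le> r \<Longrightarrow> 0 \<le> \<alpha> r"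
  by (cases "r = 0") (auto simp: class_P_def intro: less_imp_le)

text \<open>The nondecreasing \<open>g\<close> lies below \<alpha> on [0,1], the nonincreasing
  \<open>h\<close> lies below \<alpha> beyond 1. Saturated by x / (1 + x), both are at most 1, so
  their product is below \<alpha> on both ranges. The extra factor r makes \<open>\<alpha>1\<close>
  strictly increasing and unbounded; the factor 1 / (1 + r) in \<open>\<alpha>2\<close> compensates
  for it.\<close>

lemma class_P_ge_increasing_times_decreasing:
  assumes "\<alpha> \<in> class_P"
  obtains \<alpha>1 \<alpha>2 where "\<alpha>1 \<in> class_K_inf" "continuous_on {0..} \<alpha>2"
    "\<And>r. 0 \<le> r \<Longrightarrow> 0 < \<alpha>2 r" "\<And>r s. 0 \<le> r \<Longrightarrow> r \<le> s \<Longrightarrow> \<alpha>2 s \<le> \<alpha>2 r"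
    "\<And>r. 0 \<le> r \<Longrightarrow> \<alpha>1 r * \<alpha>2 r \<le> \<alpha> r"
proof -
  note nn = class_P_nonneg[OF assms]
  define P where "P = (\<lambda>s. (s, \<alpha> s)) ` {0..1}"
  \<comment> \<open>Reflecting the arguments turns the nondecreasing convolution into a
    nonincreasing minorant: in \<open>h r\<close> the points s \<le> r are free and a point s > r
    costs s - r.\<close>
  define Q where "Q = (\<lambda>s. (- s, \<alpha> s)) ` {1..}"
  have P: "P \<noteq> {}" "P \<subseteq> UNIV \<times> {0..}" unfolding P_def by (simp, rule image_subsetI, simp add: nn)
  have Q: "Q \<noteq> {}" "Q \<subseteq> UNIV \<times> {0..}" unfolding Q_def by (simp, rule image_subsetI, simp add: nn)
  define g where "g = inf_conv P"
  define h where "h r = inf_conv Q (- r)" for r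
  have g0: "0 \<le> g r" for r unfolding g_def by (rule inf_conv_ge[OF P(1)]) (use P(2) in force)
  have h0: "0 \<le> h r" for r unfolding h_def by (rule inf_conv_ge[OF Q(1)]) (use Q(2) in force)
  have gpos: "0 < g r" if r: "0 < r" for r
  proof -
    obtain \<delta> where \<delta>: "0 < \<delta>" "\<And>s. r / 2 \<le> s \<Longrightarrow> s \<le> 1 \<Longrightarrow> \<delta> \<le> \<alpha> s"
      using class_P_bounded_below[OF assms, of "r / 2" 1] r by auto
    have "min \<delta> (r / 2) \<le> g r"
      unfolding g_def
    proof (rule inf_conv_ge_radius[OF P])
      fix s c assume "(s, c) \<in> P" "r - min \<delta> (r / 2) \<le> s"
      then have "r / 2 \<le> s" "s \<le> 1" "c = \<alpha> s" by (auto simp: P_def min_def split: if_splits)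
      then show "min \<delta> (r / 2) \<le> c" using \<delta>(2)[of s] by simp
    qed
    then show ?thesis using \<delta>(1) r by linarith
  qed
  have hpos: "0 < h r" if r: "0 \<le> r" for r
  proof -
    obtain \<delta> where \<delta>: "0 < \<delta>" "\<And>s. 1 \<le> s \<Longrightarrow> s \<le> r + 1 \<Longrightarrow> \<delta> \<le> \<alpha> s"
      using class_P_bounded_below[OF assms, of 1 "r + 1"] by auto
    have "min \<delta> 1 \<le> h r"
      unfolding h_def
    proof (rule inf_conv_ge_radius[OF Q])
      fix s c assume "(s, c) \<in> Q" "- r - min \<delta> 1 \<le> s"
      then have "1 \<le> - s" "- s \<le> r + 1" "c = \<alpha> (- s)"
        by (auto simp: Q_def min_def split: if_splits)
      then show "min \<delta> 1 \<le> c" using \<delta>(2)[of "- s"] by simp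
    qed
    then show ?thesis using \<delta> by linarith
  qed
  have gmono: "g r \<le> g s" if "r \<le> s" for r s
    unfolding g_def by (rule inf_conv_mono[OF P that])
  have hmono: "h s \<le> h r" if "r \<le> s" for r s
    unfolding h_def by (rule inf_conv_mono[OF Q]) (use that in simp_all)
  have gc: "continuous_on S g" for S unfolding g_def by (rule continuous_inf_conv[OF P])
  have hc: "continuous_on S h" for S unfolding h_def
    by (rule continuous_on_compose2[OF continuous_inf_conv[OF Q, of UNIV] continuous_on_minus[OF continuous_on_id]])
      simp
  have sat: "x / (1 + x) \<le> y / (1 + y)" if "0 \<le> x" "x \<le> y" for x y :: real
    using that by (simp add: field_simps)
  have bd: "0 \<le> x / (1 + x)" "x / (1 + x) \<le> x" "x / (1 + x) \<le> 1" if "0 \<le> x" for x :: real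
    using that by (simp_all add: pos_divide_le_eq distrib_left)
  define \<alpha>1 where "\<alpha>1 r = r * (g r / (1 + g r))" for r
  define \<alpha>2 where "\<alpha>2 r = h r / (1 + h r) * (1 / (1 + r))" for r
  have "\<alpha>1 \<in> class_K" unfolding \<alpha>1_def
  proof (rule class_K_mult)
    show "(\<lambda>r. r) \<in> class_K" by (auto intro: class_KI continuous_on_id)
    show "continuous_on {0..} (\<lambda>r. g r / (1 + g r))"
      by (intro continuous_intros gc ballI order.strict_implies_not_eq[symmetric] add_pos_nonneg g0) simp
    show "0 < g r / (1 + g r)" if "0 < r" for r using gpos[OF that] by simp
    show "g r / (1 + g r) \<le> g s / (1 + g s)" if "r \<le> s" for r s
      by (rule sat[OF g0 gmono[OF that]])
  qed
  moreover have "\<exists>r\<ge>0. N < \<alpha>1 r" for N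
  proof -
    define q where "q = g 1 / (1 + g 1)"
    have q: "0 < q" using gpos[of 1] by (simp add: q_def)
    \<comment> \<open>For r \<ge> 1 the saturated factor is at least its value \<open>q\<close> at
      1, so the linear factor alone can be made to exceed any bound.\<close>
    define r where "r = max 1 ((\<bar>N\<bar> + 1) / q)"
    have "(\<bar>N\<bar> + 1) / q * q \<le> r * q" unfolding r_def using q by (intro mult_right_mono) auto
    then have "\<bar>N\<bar> + 1 \<le> r * q" using q by simp
    also have "\<dots> \<le> \<alpha>1 r"
      unfolding \<alpha>1_def q_def by (intro mult_left_mono sat g0 gmono) (auto simp: r_def)
    finally show ?thesis by (intro exI[of _ r]) (auto simp: r_def)
  qed
  ultimately have "\<alpha>1 \<in> class_K_inf" by (rule class_K_infI)
  moreover have "continuous_on {0..} \<alpha>2" unfolding \<alpha>2_def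
    by (intro continuous_intros hc ballI order.strict_implies_not_eq[symmetric] add_pos_nonneg h0)
      simp_all
  moreover have "0 < \<alpha>2 r" if "0 \<le> r" for r
    using hpos[OF that] that by (simp add: \<alpha>2_def)
  moreover have "\<alpha>2 s \<le> \<alpha>2 r" if "0 \<le> r" "r \<le> s" for r s
    unfolding \<alpha>2_def
  proof (rule mult_mono)
    show "h s / (1 + h s) \<le> h r / (1 + h r)" by (rule sat[OF h0 hmono[OF that(2)]])
    show "1 / (1 + s) \<le> 1 / (1 + r)" using that by (intro divide_left_mono) auto
    show "0 \<le> h r / (1 + h r)" by (rule bd(1)[OF h0])
    show "0 \<le> 1 / (1 + s)" using that by simp
  qed
  moreover have "\<alpha>1 r * \<alpha>2 r \<le> \<alpha> r" if r: "0 \<le> r" for r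
  proof -
    define u where "u = g r / (1 + g r)"
    define v where "v = h r / (1 + h r)"
    have uv: "0 \<le> u" "0 \<le> v" "u \<le> g r" "v \<le> h r" "u \<le> 1" "v \<le> 1"
      unfolding u_def v_def by (rule bd[OF g0] bd[OF h0])+
    have "\<alpha>1 r * \<alpha>2 r = r / (1 + r) * (u * v)"
      by (simp add: \<alpha>1_def \<alpha>2_def u_def v_def ac_simps)
    also have "\<dots> \<le> 1 * (u * v)"
      by (intro mult_right_mono bd(3)[OF r] mult_nonneg_nonneg uv)
    also have "u * v \<le> \<alpha> r"
    proof (cases "r \<le> 1")
      case True
      then have "(r, \<alpha> r) \<in> P" using r by (auto simp: P_def)
      from inf_conv_le[OF P(2) this, of r] have "g r \<le> \<alpha> r" by (simp add: g_def)
      moreover have "u * v \<le> u" using uv by (simp add: mult_left_le)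
      ultimately show ?thesis using uv by linarith
    next
      case False
      then have "(- r, \<alpha> r) \<in> Q" by (auto simp: Q_def)
      from inf_conv_le[OF Q(2) this, of "- r"] have "h r \<le> \<alpha> r" by (simp add: h_def)
      moreover have "u * v \<le> v" using uv by (simp add: mult_left_le_one_le)
      ultimately show ?thesis using uv by linarith
    qed
    finally show ?thesis by simp
  qed
  ultimately show ?thesis using that by blast
qed

text \<open>Pairs in \<open>W\<close> are the arguments and gain values to be avoided. Forbidden
  gain values are bounded away from 0 for s away from 0, and by \<open>ev\<close> they exceed any
  bound for large s, so the convolution over \<open>W\<close> is positive and unbounded. The factor
  r / (1 + r) makes it strictly increasing and, being less than 1, keeps it strictly below
  \<open>W\<close>.\<close>

lemma class_K_inf_gain_below:
  assumes "\<alpha> \<in> class_P" "\<sigma> \<in> class_K"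
    and ev: "\<And>c. 0 \<le> c \<Longrightarrow> eventually (\<lambda>r. \<sigma> c < \<alpha> r) at_top"
  obtains \<eta> where "\<eta> \<in> class_K_inf" "\<And>r. 0 < r \<Longrightarrow> \<sigma> (\<eta> r) < \<alpha> r"
proof -
  \<comment> \<open>\<open>\<eta>\<close> has to stay strictly below this set of pairs.\<close>
  define W where "W = {(s, c). 0 \<le> s \<and> 0 \<le> c \<and> \<alpha> s \<le> \<sigma> c}"
  have "(0, 0) \<in> W" using assms(1) class_KD(2)[OF assms(2)] by (auto simp: W_def class_P_def)
  then have W: "W \<noteq> {}" "W \<subseteq> UNIV \<times> {0..}" by (auto simp: W_def)
  have large: "\<exists>R. \<forall>s c. (s, c) \<in> W \<longrightarrow> R \<le> s \<longrightarrow> N < c" if "0 \<le> N" for N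
  proof -
    from ev[OF that] obtain R where R: "\<And>s. R \<le> s \<Longrightarrow> \<sigma> N < \<alpha> s"
      by (auto simp: eventually_at_top_linorder)
    have "N < c" if "(s, c) \<in> W" "R \<le> s" for s c
      using R[OF that(2)] that(1) class_K_mono[OF assms(2), of c N] by (force simp: W_def)
    then show ?thesis by blast
  qed
  have pos: "0 < inf_conv W r" if r: "0 < r" for r
  proof -
    obtain R where R: "\<And>s c. (s, c) \<in> W \<Longrightarrow> R \<le> s \<Longrightarrow> 1 < c" using large[of 1] by auto
    obtain \<delta> where \<delta>: "0 < \<delta>" "\<And>s. r / 2 \<le> s \<Longrightarrow> s \<le> R \<Longrightarrow> \<delta> \<le> \<alpha> s"
      using class_P_bounded_below[OF assms(1), of "r / 2" R] r by auto
    have "(\<sigma> \<longlongrightarrow> \<sigma> 0) (at 0 within {0..})"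
      using class_KD(1)[OF assms(2)] by (auto simp: continuous_on_def)
    moreover have "{0<..} \<subseteq> {0::real..}" by auto
    ultimately have "(\<sigma> \<longlongrightarrow> \<sigma> 0) (at_right 0)" by (rule tendsto_within_subset)
    then have "(\<sigma> \<longlongrightarrow> 0) (at_right 0)" using class_KD(2)[OF assms(2)] by simp
    then have "eventually (\<lambda>\<epsilon>. \<sigma> \<epsilon> < \<delta>) (at_right 0)" using \<delta>(1) by (rule order_tendstoD)
    then obtain e where e: "0 < e" "\<And>x. 0 < x \<Longrightarrow> x < e \<Longrightarrow> \<sigma> x < \<delta>"
      by (auto simp: eventually_at_right_field)
    \<comment> \<open>The bound e / 2 gives \<open>\<sigma> \<epsilon> < \<delta>\<close>, r / 2
      keeps the relevant s in the range where \<alpha> is at least \<delta>, and 1 serves the tail s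
      \<ge> R, where c > 1.\<close>
    define \<epsilon> where "\<epsilon> = min (min (e / 2) (r / 2)) 1"
    have \<epsilon>: "0 < \<epsilon>" "\<sigma> \<epsilon> < \<delta>" "\<epsilon> \<le> r / 2" "\<epsilon> \<le> 1" using e r by (auto simp: \<epsilon>_def)
    have "\<epsilon> \<le> inf_conv W r"
    proof (rule inf_conv_ge_radius[OF W])
      fix s c assume sc: "(s, c) \<in> W" "r - \<epsilon> \<le> s"
      show "\<epsilon> \<le> c"
      proof (cases "R \<le> s")
        case True
        then show ?thesis using R[OF sc(1)] \<epsilon> by simp
      next
        case False
        then have "\<sigma> \<epsilon> < \<sigma> c" using \<delta>(2)[of s] sc \<epsilon> by (auto simp: W_def)
        then show ?thesis using class_K_le_cancel[OF assms(2), of c \<epsilon>] sc W by force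
      qed
    qed
    then show ?thesis using \<epsilon> by linarith
  qed
  define \<eta> where "\<eta> r = r / (1 + r) * inf_conv W r" for r
  have "\<eta> \<in> class_K" unfolding \<eta>_def
  proof (rule class_K_mult)
    show "(\<lambda>r. r / (1 + r)) \<in> class_K"
    proof (rule class_KI)
      show "continuous_on {0..} (\<lambda>r :: real. r / (1 + r))" by (intro continuous_intros) auto
    qed (auto simp: field_simps)
    show "inf_conv W r \<le> inf_conv W s" if "r \<le> s" for r s by (rule inf_conv_mono[OF W that])
  qed (use continuous_inf_conv[OF W] pos in auto)
  moreover have "\<exists>r\<ge>0. N < \<eta> r" for N
  proof -
    \<comment> \<open>Doubled because the factor r / (1 + r) may halve the convolution: it is at
      least 1/2 for r \<ge> 1.\<close>
    define N' where "N' = 2 * (\<bar>N\<bar> + 1)"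
    obtain R where R: "\<And>s c. (s, c) \<in> W \<Longrightarrow> R \<le> s \<Longrightarrow> N' < c"
      using large[of N'] by (auto simp: N'_def)
    define r where "r = max 1 (R + N')"
    have "N' \<le> inf_conv W r"
    proof (rule inf_conv_ge_radius[OF W])
      fix s c assume sc: "(s, c) \<in> W" "r - N' \<le> s"
      then have "R \<le> s" by (simp add: r_def max_def split: if_splits)
      then show "N' \<le> c" using R[OF sc(1)] by simp
    qed
    moreover have "1 / 2 \<le> r / (1 + r)" by (simp add: r_def field_simps max_def)
    ultimately have "1 / 2 * N' \<le> \<eta> r"
      unfolding \<eta>_def by (intro mult_mono) (auto simp: N'_def r_def)
    then show ?thesis by (intro exI[of _ r]) (auto simp: N'_def r_def)
  qed
  ultimately have "\<eta> \<in> class_K_inf" by (rule class_K_infI)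
  moreover have "\<sigma> (\<eta> r) < \<alpha> r" if r: "0 < r" for r
  proof (rule ccontr)
    assume "\<not> ?thesis"
    then have "(r, \<eta> r) \<in> W"
      using r class_K_nonneg[OF \<open>\<eta> \<in> class_K\<close>] by (auto simp: W_def)
    from inf_conv_le[OF W(2) this, of r] have "inf_conv W r \<le> \<eta> r" by simp
    moreover have "\<eta> r < 1 * inf_conv W r"
      unfolding \<eta>_def using r pos[OF r] by (intro mult_strict_right_mono) auto
    ultimately show False by simp
  qed
  ultimately show ?thesis using that by blast
qed

text \<open>The limit of \<sigma> is its supremum in the extended reals, which a strictly increasing
  function does not attain: \<sigma>(c) < \<sigma>(c + 1) already separates \<sigma>(c) from
  it.\<close>

lemma class_K_Liminf_ge_Lim_imp_eventually_greater:
  assumes "\<sigma> \<in> class_K" "0 \<le> c"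
    and "Liminf at_top (\<lambda>\<tau>. ereal (\<alpha> \<tau>)) \<ge> Lim at_top (\<lambda>\<tau>. ereal (\<sigma> \<tau>))"
  shows "eventually (\<lambda>r. \<sigma> c < \<alpha> r) at_top"
proof -
  define l where "l = (SUP t\<in>{0..}. ereal (\<sigma> t))"
  have "((\<lambda>t. ereal (\<sigma> t)) \<longlongrightarrow> l) at_top"
  proof (rule order_tendstoI)
    fix a assume "a < l"
    then obtain t where t: "0 \<le> t" "a < ereal (\<sigma> t)" by (auto simp: l_def less_SUP_iff)
    show "eventually (\<lambda>t. a < ereal (\<sigma> t)) at_top"
      using eventually_ge_at_top[of t]
    proof eventually_elim
      case (elim u)
      then show ?case
        using t(2) class_K_mono[OF assms(1) t(1) elim] by (metis ereal_less_eq(3) less_le_trans)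
    qed
  next
    fix a assume a: "l < a"
    show "eventually (\<lambda>t. ereal (\<sigma> t) < a) at_top"
      using eventually_ge_at_top[of 0]
    proof eventually_elim
      case (elim t)
      then have "ereal (\<sigma> t) \<le> l" unfolding l_def by (intro SUP_upper) auto
      then show ?case using a by (rule le_less_trans)
    qed
  qed
  then have "Lim at_top (\<lambda>\<tau>. ereal (\<sigma> \<tau>)) = l" by (intro tendsto_Lim) auto
  moreover have "ereal (\<sigma> c) < l"
  proof -
    have "ereal (\<sigma> c) < ereal (\<sigma> (c + 1))" using class_K_less[OF assms(1,2), of "c + 1"] by simp
    also have "\<dots> \<le> l" unfolding l_def using assms(2) by (intro SUP_upper) auto
    finally show ?thesis .
  qed
  ultimately have "ereal (\<sigma> c) < Liminf at_top (\<lambda>\<tau>. ereal (\<alpha> \<tau>))" using assms(3) by simp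
  from less_LiminfD[OF this] show ?thesis by simp
qed

text \<open>
  On the range where \<open>a \<le> \<psi>2(g s)\<close> and \<open>\<psi>1(g s) \<le> 2 b\<close>, the integrand is at least \<open>\<rho>(a) d(b)\<close>
  for some \<open>\<rho>\<close> of class K and some positive decreasing \<open>d\<close>, hence \<open>t \<rho>(a) d(b) \<le> b\<close>. Adding \<open>\<rho>(a) \<le> \<rho>(b)\<close> gives \<open>\<rho>(a) (1 + t d(b)) \<le> \<rho>(b) + b\<close>, which is solved for
  \<open>a\<close>; no comparison with an ordinary differential equation is needed.
\<close>

lemma class_KL_decay:
  assumes "\<alpha> \<in> class_P" "\<psi>1 \<in> class_K_inf" "\<psi>2 \<in> class_K_inf"
  obtains \<beta> where "\<beta> \<in> class_KL"
    "\<And>a b t g. 0 \<le> a \<Longrightarrow> a \<le> b \<Longrightarrow> 0 \<le> t \<Longrightarrow> continuous_on {0..t} g \<Longrightarrow>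
       (\<And>s. s \<in> {0..t} \<Longrightarrow> 0 \<le> g s \<and> a \<le> \<psi>2 (g s) \<and> \<psi>1 (g s) \<le> 2 * b) \<Longrightarrow>
       integral {0..t} (\<lambda>s. \<alpha> (g s)) \<le> b \<Longrightarrow> a \<le> \<beta> b t"
proof -
  obtain \<alpha>1 \<alpha>2 where \<alpha>1: "\<alpha>1 \<in> class_K_inf" and \<alpha>2: "continuous_on {0..} \<alpha>2"
    "\<And>r. 0 \<le> r \<Longrightarrow> 0 < \<alpha>2 r" "\<And>r s. 0 \<le> r \<Longrightarrow> r \<le> s \<Longrightarrow> \<alpha>2 s \<le> \<alpha>2 r"
    and \<alpha>12: "\<And>r. 0 \<le> r \<Longrightarrow> \<alpha>1 r * \<alpha>2 r \<le> \<alpha> r"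
    using class_P_ge_increasing_times_decreasing[OF assms(1)] by blast
  obtain \<phi>1 where \<phi>1: "\<phi>1 \<in> class_K_inf" "\<And>r. 0 \<le> r \<Longrightarrow> \<phi>1 (\<psi>1 r) = r" "\<And>r. 0 \<le> r \<Longrightarrow> \<psi>1 (\<phi>1 r) = r"
    using class_K_inf_inverse[OF assms(2)] by blast
  obtain \<phi>2 where \<phi>2: "\<phi>2 \<in> class_K_inf" "\<And>r. 0 \<le> r \<Longrightarrow> \<phi>2 (\<psi>2 r) = r" "\<And>r. 0 \<le> r \<Longrightarrow> \<psi>2 (\<phi>2 r) = r"
    using class_K_inf_inverse[OF assms(3)] by blast
  obtain \<kappa>1 where \<kappa>1: "\<kappa>1 \<in> class_K_inf" "\<And>r. 0 \<le> r \<Longrightarrow> \<kappa>1 (\<alpha>1 r) = r" "\<And>r. 0 \<le> r \<Longrightarrow> \<alpha>1 (\<kappa>1 r) = r"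
    using class_K_inf_inverse[OF \<alpha>1] by blast
  note K = class_K_inf_imp_K[OF \<alpha>1] class_K_inf_imp_K[OF \<phi>1(1)] class_K_inf_imp_K[OF \<phi>2(1)]
    class_K_inf_imp_K[OF \<kappa>1(1)] class_K_inf_imp_K[OF assms(2)] class_K_inf_imp_K[OF assms(3)]
  define \<rho> where "\<rho> r = \<alpha>1 (\<phi>2 r)" for r
  \<comment> \<open>The inverse of \<open>\<rho>\<close>, since \<open>\<kappa>1\<close> inverts
    \<open>\<alpha>1\<close> and \<open>\<psi>2\<close> inverts \<open>\<phi>2\<close>.\<close>
  define \<kappa> where "\<kappa> r = \<psi>2 (\<kappa>1 r)" for r
  \<comment> \<open>The bound \<open>\<psi>1 (g s) \<le> 2 * b\<close> means
    \<open>g s \<le> \<phi>1 (2 * b)\<close>; \<open>\<alpha>2\<close>, being nonincreasing, is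
    smallest at that end.\<close>
  define d where "d b = \<alpha>2 (\<phi>1 (2 * b))" for b
  define N where "N b = \<rho> b + b" for b
  have \<rho>K: "\<rho> \<in> class_K" unfolding \<rho>_def by (rule class_K_compose[OF K(1,3)])
  have \<kappa>K: "\<kappa> \<in> class_K" unfolding \<kappa>_def by (rule class_K_compose[OF K(6,4)])
  have \<kappa>\<rho>: "\<kappa> (\<rho> r) = r" if "0 \<le> r" for r
    using that \<kappa>1(2)[of "\<phi>2 r"] \<phi>2(3)[of r] class_K_nonneg[OF K(3)] by (simp add: \<kappa>_def \<rho>_def)
  have NK: "N \<in> class_K" unfolding N_def
    using class_KD(2)[OF \<rho>K] class_K_less[OF \<rho>K]
    by (intro class_KI continuous_intros class_KD(1)[OF \<rho>K]) (auto intro: add_strict_mono)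
  have \<phi>1K: "(\<lambda>b. \<phi>1 (2 * b)) \<in> class_K" by (rule class_K_scale[OF K(2)]) simp
  have dc: "continuous_on {0..} d" unfolding d_def
    by (rule continuous_on_compose2[OF \<alpha>2(1) class_KD(1)[OF \<phi>1K]])
      (use class_K_nonneg[OF \<phi>1K] in auto)
  have dpos: "0 < d b" if "0 \<le> b" for b
    unfolding d_def by (rule \<alpha>2(2)[OF class_K_nonneg[OF \<phi>1K that]])
  have dmono: "d b' \<le> d b" if "0 \<le> b" "b \<le> b'" for b b'
    unfolding d_def using that
    by (intro \<alpha>2(3) class_K_nonneg[OF \<phi>1K] class_K_mono[OF \<phi>1K])
  define \<beta> where "\<beta> b t = \<kappa> (N b / (1 + t * d b))" for b t
  have "\<beta> \<in> class_KL"
    unfolding \<beta>_def by (rule class_KL_explicit[OF \<kappa>K NK dc dpos dmono])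
  moreover have "a \<le> \<beta> b t"
    if a: "0 \<le> a" "a \<le> b" and t: "0 \<le> t" and g: "continuous_on {0..t} g"
      "\<And>s. s \<in> {0..t} \<Longrightarrow> 0 \<le> g s \<and> a \<le> \<psi>2 (g s) \<and> \<psi>1 (g s) \<le> 2 * b"
      and i: "integral {0..t} (\<lambda>s. \<alpha> (g s)) \<le> b" for a b t g
  proof -
    have b: "0 \<le> b" using a by simp
    have lower: "\<rho> a * d b \<le> \<alpha> (g s)" if s: "s \<in> {0..t}" for s
    proof -
      have gs: "0 \<le> g s" "a \<le> \<psi>2 (g s)" "\<psi>1 (g s) \<le> 2 * b" using g(2)[OF s] by auto
      have "\<phi>2 a \<le> g s" using class_K_mono[OF K(3) a(1) gs(2)] \<phi>2(2)[OF gs(1)] by simp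
      then have "\<rho> a \<le> \<alpha>1 (g s)"
        unfolding \<rho>_def by (intro class_K_mono[OF K(1)] class_K_nonneg[OF K(3) a(1)])
      moreover have "g s \<le> \<phi>1 (2 * b)"
        using class_K_mono[OF K(2) class_K_nonneg[OF K(5) gs(1)] gs(3)] \<phi>1(2)[OF gs(1)] by simp
      then have "d b \<le> \<alpha>2 (g s)" unfolding d_def by (rule \<alpha>2(3)[OF gs(1)])
      ultimately have "\<rho> a * d b \<le> \<alpha>1 (g s) * \<alpha>2 (g s)"
        using dpos[OF b] class_K_nonneg[OF K(1) gs(1)] by (intro mult_mono) auto
      also have "\<dots> \<le> \<alpha> (g s)" by (rule \<alpha>12[OF gs(1)])
      finally show ?thesis .
    qed
    have "continuous_on {0..t} (\<lambda>s. \<alpha> (g s))"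
      by (rule continuous_on_compose2[OF _ g(1), of "{0..}"])
        (use assms(1) g(2) in \<open>auto simp: class_P_def\<close>)
    then have "integral {0..t} (\<lambda>s. \<rho> a * d b) \<le> integral {0..t} (\<lambda>s. \<alpha> (g s))"
      by (intro integral_le integrable_continuous_real lower) auto
    then have "t * (\<rho> a * d b) \<le> b" using i t by (simp add: mult_ac)
    \<comment> \<open>The integral bound alone says nothing at t = 0. This second bound, valid at
      all times, supplies the 1 in the denominator.\<close>
    moreover have "\<rho> a \<le> \<rho> b" by (rule class_K_mono[OF \<rho>K a])
    ultimately have "\<rho> a * (1 + t * d b) \<le> N b" by (simp add: N_def algebra_simps)
    moreover have "0 < 1 + t * d b" using dpos[OF b] t by (simp add: add_pos_nonneg)
    ultimately have "\<rho> a \<le> N b / (1 + t * d b)" by (simp add: pos_le_divide_eq)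
    then show ?thesis
      using class_K_mono[OF \<kappa>K class_K_nonneg[OF \<rho>K a(1)]] \<kappa>\<rho>[OF a(1)] by (simp add: \<beta>_def)
  qed
  ultimately show ?thesis using that by blast
qed

subsection \<open>Strongly continuous semigroups\<close>

lemma C0_semigroupD:
  assumes "C0_semigroup T"
  shows "T 0 = id_blinfun" "\<And>s t. 0 \<le> s \<Longrightarrow> 0 \<le> t \<Longrightarrow> T (s + t) = T s o\<^sub>L T t"
    "\<And>x. ((\<lambda>t. blinfun_apply (T t) x) \<longlongrightarrow> x) (at_right 0)"
  using assms by (auto simp: C0_semigroup_def)

text \<open>A uniform boundedness argument: the closed sets \<open>K n\<close> cover the space, so
  by Baire's theorem one of them contains a ball, on which the operators near time 0 are bounded
  simultaneously.\<close>

lemma C0_semigroup_bounded_near_0: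
  assumes "C0_semigroup T"
  obtains \<delta> M where "0 < \<delta>" "\<And>t. t \<in> {0..\<delta>} \<Longrightarrow> norm (T t) \<le> M"
proof -
  \<comment> \<open>The time interval shrinks with n because strong continuity at 0 bounds each
    orbit only on an interval depending on the vector.\<close>
  define K where "K n = (\<Inter>t\<in>{0..1 / real (Suc n)}. {x. norm (T t x) \<le> real n})" for n
  have closed: "closed (K n)" for n
    unfolding K_def by (intro closed_INT ballI closed_Collect_le continuous_intros)
  have cover: "\<exists>n. x \<in> K n" for x
  proof -
    have "((\<lambda>t. norm (T t x)) \<longlongrightarrow> norm x) (at_right 0)"
      by (rule tendsto_norm[OF C0_semigroupD(3)[OF assms]])
    then have "eventually (\<lambda>t. norm (T t x) < norm x + 1) (at_right 0)"
      by (rule order_tendstoD) simp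
    then obtain d where d: "0 < d" "\<And>t. 0 < t \<Longrightarrow> t < d \<Longrightarrow> norm (T t x) < norm x + 1"
      by (auto simp: eventually_at_right_field)
    obtain n1 where n1: "inverse (real (Suc n1)) < d" using reals_Archimedean[OF d(1)] by blast
    obtain n2 where n2: "norm x + 1 \<le> real n2" using real_arch_simple by blast
    define n where "n = max n1 n2"
    have "norm (T t x) \<le> real n" if t: "t \<in> {0..1 / real (Suc n)}" for t
    proof (cases "t = 0")
      case True
      then show ?thesis using n2 C0_semigroupD(1)[OF assms] by (simp add: n_def)
    next
      case False
      have "1 / real (Suc n) \<le> inverse (real (Suc n1))"
        by (simp add: n_def divide_inverse le_imp_inverse_le)
      then have "norm (T t x) < norm x + 1" using d(2)[of t] t False n1 by auto
      then show ?thesis using n2 by (simp add: n_def)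
    qed
    then have "x \<in> K n" by (simp add: K_def del: of_nat_Suc)
    then show ?thesis ..
  qed
  have "\<exists>n. interior (K n) \<noteq> {}"
  proof (rule ccontr)
    assume "\<not> ?thesis"
    then have e: "interior (K n) = {}" for n by blast
    have "euclidean interior_of \<Union>(range K) = {}"
    proof (rule Baire_category_alt)
      show "completely_metrizable_space (euclidean :: 'a topology) \<or>
          locally_compact_space (euclidean :: 'a topology) \<and> regular_space (euclidean :: 'a topology)"
        using completely_metrizable_space_euclidean by blast
    qed (use closed e in auto)
    moreover have "\<Union>(range K) = UNIV" using cover by auto
    ultimately show False by simp
  qed
  then obtain n x0 where "x0 \<in> interior (K n)" by blast
  then obtain r where r: "0 < r" "cball x0 r \<subseteq> K n" by (auto simp: mem_interior_cball)
  have "norm (T t) \<le> 2 * real n / r" if t: "t \<in> {0..1 / real (Suc n)}" for t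
  proof (rule norm_blinfun_bound)
    have K: "norm (T t x) \<le> real n" if "x \<in> cball x0 r" for x
      using r(2) that t by (auto simp: K_def)
    show "0 \<le> 2 * real n / r" using r by simp
    fix y
    show "norm (T t y) \<le> 2 * real n / r * norm y"
    proof (cases "y = 0")
      case False
      \<comment> \<open>Rescaled to length r, the vector is the difference of two points of the
        ball, which explains the constant 2 n / r.\<close>
      define z where "z = (r / norm y) *\<^sub>R y"
      have z: "y = (norm y / r) *\<^sub>R z" "norm z = r" using r False by (simp_all add: z_def)
      have "T t z = T t (x0 + z) - T t x0" by (simp add: blinfun.add_right)
      also have "norm \<dots> \<le> norm (T t (x0 + z)) + norm (T t x0)" by (rule norm_triangle_ineq4)
      also have "\<dots> \<le> 2 * real n"
        using K[of "x0 + z"] K[of x0] z(2) r by (simp add: dist_norm)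
      finally have "norm (T t z) \<le> 2 * real n" .
      have "norm (T t y) = norm y / r * norm (T t z)"
        using r by (subst z(1)) (simp add: blinfun.scaleR_right)
      also have "\<dots> \<le> norm y / r * (2 * real n)"
        using r \<open>norm (T t z) \<le> 2 * real n\<close> by (intro mult_left_mono) auto
      finally show ?thesis by (simp add: mult_ac)
    qed simp
  qed
  then show ?thesis by (intro that[of "1 / real (Suc n)"]) auto
qed

text \<open>The semigroup law carries the bound near 0 along steps of length \<delta>, at the price
  of a factor \<open>M0\<close> per step.\<close>

lemma C0_semigroup_locally_bounded:
  assumes "C0_semigroup T"
  obtains M where "0 < M" "\<And>t. t \<in> {0..\<tau>} \<Longrightarrow> norm (T t) \<le> M"
proof -
  obtain \<delta> M0 where \<delta>: "0 < \<delta>" and M0: "\<And>t. t \<in> {0..\<delta>} \<Longrightarrow> norm (T t) \<le> M0"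
    using C0_semigroup_bounded_near_0[OF assms] by blast
  have M0nn: "0 \<le> M0" using M0[of 0] \<delta> norm_ge_zero[of "T 0"] by (simp del: norm_ge_zero)
  have "\<exists>M. \<forall>t\<in>{0..real n * \<delta>}. norm (T t) \<le> M" for n
  proof (induction n)
    case 0
    show ?case by (intro exI[of _ "norm (T 0)"]) auto
  next
    case (Suc n)
    then obtain M where M: "\<And>t. t \<in> {0..real n * \<delta>} \<Longrightarrow> norm (T t) \<le> M" by blast
    have "norm (T t) \<le> M0 * M" if t: "t \<in> {0..real (Suc n) * \<delta>}" for t
    proof -
      define a where "a = min t \<delta>"
      have a: "a \<in> {0..\<delta>}" "t - a \<in> {0..real n * \<delta>}"
        using t \<delta> by (auto simp: a_def min_def algebra_simps)
      have "T t = T a o\<^sub>L T (t - a)" using C0_semigroupD(2)[OF assms, of a "t - a"] a by simp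
      then have "norm (T t) \<le> norm (T a) * norm (T (t - a))" by (simp add: norm_blinfun_compose)
      also have "\<dots> \<le> M0 * M" by (intro mult_mono M0 M a M0nn) simp
      finally show ?thesis .
    qed
    then show ?case by blast
  qed
  moreover obtain n where "\<tau> / \<delta> \<le> real n" using real_arch_simple by blast
  then have "\<tau> \<le> real n * \<delta>" using \<delta> by (simp add: pos_divide_le_eq)
  ultimately obtain M where "\<And>t. t \<in> {0..\<tau>} \<Longrightarrow> norm (T t) \<le> M" by (meson atLeastAtMost_iff order_trans)
  then show ?thesis using that[of "max M 1"] by force
qed

text \<open>For a \<le> b, factoring out \<open>T a\<close> reduces the increment of the orbit to
  strong continuity at 0. Taking the smaller time as a treats left and right continuity alike, and
  the local bound makes the estimate uniform in a.\<close>

lemma C0_semigroup_orbit_continuous: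
  assumes "C0_semigroup T"
  shows "continuous_on {0..} (\<lambda>t. T t x)"
  unfolding continuous_on_iff
proof (intro ballI allI impI)
  fix t e :: real assume t: "t \<in> {0..}" and e: "0 < e"
  obtain M where M: "0 < M" "\<And>s. s \<in> {0..t + 1} \<Longrightarrow> norm (T s) \<le> M"
    using C0_semigroup_locally_bounded[OF assms, of "t + 1"] by blast
  have "eventually (\<lambda>h. dist (T h x) x < e / M) (at_right 0)"
    using C0_semigroupD(3)[OF assms, of x] e M(1) by (intro tendstoD) auto
  then obtain d where d: "0 < d" "\<And>h. 0 < h \<Longrightarrow> h < d \<Longrightarrow> norm (T h x - x) < e / M"
    by (auto simp: eventually_at_right_field dist_norm)
  have close: "norm (T b x - T a x) < e"
    if ab: "0 \<le> a" "a \<le> b" "a \<le> t + 1" "b - a < d" for a b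
  proof (cases "a = b")
    case False
    have "T b = T a o\<^sub>L T (b - a)" using C0_semigroupD(2)[OF assms, of a "b - a"] ab by simp
    then have "T b x - T a x = T a (T (b - a) x - x)" by (simp add: blinfun.diff_right)
    then have "norm (T b x - T a x) \<le> norm (T a) * norm (T (b - a) x - x)"
      by (simp add: norm_blinfun)
    also have "\<dots> \<le> M * norm (T (b - a) x - x)"
      using M(2)[of a] ab by (intro mult_right_mono) auto
    also have "\<dots> < M * (e / M)"
      using d(2)[of "b - a"] ab False M(1) by (intro mult_strict_left_mono) auto
    finally show ?thesis using M(1) by simp
  qed (use e in simp)
  show "\<exists>d>0. \<forall>s\<in>{0..}. dist s t < d \<longrightarrow> dist (T s x) (T t x) < e"
  proof (intro exI[of _ "min d 1"] conjI ballI impI)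
    fix s assume s: "s \<in> {0..}" "dist s t < min d 1"
    show "dist (T s x) (T t x) < e"
    proof (cases "s \<le> t")
      case True
      then have "norm (T t x - T s x) < e" using s t by (intro close) (auto simp: dist_real_def)
      then show ?thesis by (simp add: dist_norm norm_minus_commute)
    next
      case False
      then show ?thesis using close[of t s] s t by (auto simp: dist_norm dist_real_def)
    qed
  qed (use d in auto)
qed

text \<open>T is continuous only strongly, not in operator norm. Hence the vector is first frozen at
  its limit \<open>g a\<close>, and the error \<open>g s - g a\<close> is absorbed by the local
  bound on T.\<close>

lemma continuous_on_C0_semigroup_apply:
  assumes "C0_semigroup T" "continuous_on S \<phi>" "\<And>s. s \<in> S \<Longrightarrow> 0 \<le> \<phi> s" "continuous_on S g"
  shows "continuous_on S (\<lambda>s. T (\<phi> s) (g s))"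
  unfolding continuous_on_def
proof
  fix a assume a: "a \<in> S"
  let ?F = "at a within S"
  have \<phi>: "(\<phi> \<longlongrightarrow> \<phi> a) ?F" and g: "(g \<longlongrightarrow> g a) ?F"
    using assms a by (auto simp: continuous_on_def)
  obtain M where M: "0 < M" "\<And>s. s \<in> {0..\<phi> a + 1} \<Longrightarrow> norm (T s) \<le> M"
    using C0_semigroup_locally_bounded[OF assms(1), of "\<phi> a + 1"] by blast
  have S: "eventually (\<lambda>s. s \<in> S) ?F" by (simp add: eventually_at_filter)
  have orbit: "((\<lambda>s. T (\<phi> s) (g a)) \<longlongrightarrow> T (\<phi> a) (g a)) ?F"
    by (rule continuous_on_tendsto_compose[OF C0_semigroup_orbit_continuous[OF assms(1)] \<phi>])
      (use S assms(3) a in \<open>auto elim: eventually_mono\<close>)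
  have "((\<lambda>s. T (\<phi> s) (g s - g a)) \<longlongrightarrow> 0) ?F"
  proof (rule Lim_null_comparison)
    have "((\<lambda>s. M * norm (g s - g a)) \<longlongrightarrow> M * norm (g a - g a)) ?F"
      by (intro tendsto_intros g)
    then show "((\<lambda>s. M * norm (g s - g a)) \<longlongrightarrow> 0) ?F" by simp
    have "eventually (\<lambda>s. \<phi> s < \<phi> a + 1) ?F" by (rule order_tendstoD(2)[OF \<phi>]) simp
    with S show "eventually (\<lambda>s. norm (T (\<phi> s) (g s - g a)) \<le> M * norm (g s - g a)) ?F"
    proof eventually_elim
      case (elim s)
      have "norm (T (\<phi> s) (g s - g a)) \<le> norm (T (\<phi> s)) * norm (g s - g a)" by (rule norm_blinfun)
      also have "\<dots> \<le> M * norm (g s - g a)"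
        using M(2)[of "\<phi> s"] assms(3) elim by (intro mult_right_mono) auto
      finally show ?case .
    qed
  qed
  from tendsto_add[OF this orbit] show "((\<lambda>s. T (\<phi> s) (g s)) \<longlongrightarrow> T (\<phi> a) (g a)) ?F"
    by (simp add: blinfun.diff_right)
qed

section \<open>Convolution with a semigroup\<close>

lemma continuous_on_C0_semigroup_convolution_integrand:
  assumes "C0_semigroup T" "continuous_on {a..b} g" "b \<le> t"
  shows "continuous_on {a..b} (\<lambda>s. T (t - s) (g s))"
  by (rule continuous_on_C0_semigroup_apply[OF assms(1) _ _ assms(2)])
    (use assms(3) in \<open>auto intro!: continuous_intros\<close>)

lemma continuous_on_C0_semigroup_convolution:
  assumes "C0_semigroup T" "continuous_on {0..\<tau>} g"
  shows "continuous_on {0..\<tau>} (\<lambda>t. integral {0..t} (\<lambda>s. T (t - s) (g s)))"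
proof -
  \<comment> \<open>Extended by \<open>g s\<close> for \<open>s \<ge> t\<close>, the integrand is jointly continuous on a fixed rectangle.\<close>
  define h where "h t s = T (max 0 (t - s)) (g s)" for t s
  have h: "continuous_on ({0..\<tau>} \<times> cbox 0 \<tau>) (\<lambda>(t, s). h t s)"
    unfolding h_def split_def
  proof (rule continuous_on_C0_semigroup_apply[OF assms(1)])
    show "continuous_on ({0..\<tau>} \<times> cbox 0 \<tau>) (\<lambda>p. g (snd p))"
      by (rule continuous_on_compose2[OF assms(2)]) (auto intro!: continuous_intros)
  qed (auto intro!: continuous_intros)
  have "integral {0..t} (\<lambda>s. T (t - s) (g s)) = integral (cbox 0 \<tau>) (h t) - integral {t..\<tau>} g"
    if t: "t \<in> {0..\<tau>}" for t
  proof -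
    have "continuous_on {0..\<tau>} (h t)" unfolding h_def
      by (rule continuous_on_C0_semigroup_apply[OF assms(1) _ _ assms(2)])
        (auto intro!: continuous_intros)
    then have "integral {0..t} (h t) + integral {t..\<tau>} (h t) = integral {0..\<tau>} (h t)"
      using t by (intro Henstock_Kurzweil_Integration.integral_combine integrable_continuous_real) auto
    moreover have "integral {0..t} (h t) = integral {0..t} (\<lambda>s. T (t - s) (g s))"
      by (rule Henstock_Kurzweil_Integration.integral_cong) (auto simp: h_def)
    moreover have "integral {t..\<tau>} (h t) = integral {t..\<tau>} g"
      by (rule Henstock_Kurzweil_Integration.integral_cong)
        (auto simp: h_def max_absorb1 C0_semigroupD(1)[OF assms(1)])
    ultimately show ?thesis by (simp add: algebra_simps)
  qed
  moreover have "continuous_on {0..\<tau>} (\<lambda>t. integral (cbox 0 \<tau>) (h t) - integral {t..\<tau>} g)"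
    by (intro continuous_on_diff integral_continuous_on_param h indefinite_integral_continuous_1'
        integrable_continuous_real assms)
  ultimately show ?thesis by (subst continuous_on_cong[OF refl]) auto
qed

text \<open>Restarting the variation of constants formula at time a: before a the operator factors
  as \<open>T r\<close> after \<open>T (a - s)\<close>, and the bounded operator \<open>T r\<close>
  comes out of the integral; after a time is translated.\<close>

lemma C0_semigroup_convolution_split:
  assumes "C0_semigroup T" "continuous_on {0..a + r} g" "0 \<le> a" "0 \<le> r"
  shows "integral {0..a + r} (\<lambda>s. T (a + r - s) (g s)) =
    T r (integral {0..a} (\<lambda>s. T (a - s) (g s))) + integral {0..r} (\<lambda>s. T (r - s) (g (a + s)))"
proof -
  have c: "continuous_on {0..a + r} (\<lambda>s. T (a + r - s) (g s))"
    by (rule continuous_on_C0_semigroup_convolution_integrand[OF assms(1,2)]) simp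
  have c0: "continuous_on {0..a} (\<lambda>s. T (a - s) (g s))"
    by (rule continuous_on_C0_semigroup_convolution_integrand[OF assms(1)])
      (use assms(4) in \<open>auto intro: continuous_on_subset[OF assms(2)]\<close>)
  have "integral {0..a} (\<lambda>s. T (a + r - s) (g s)) = integral {0..a} (\<lambda>s. T r (T (a - s) (g s)))"
  proof (rule Henstock_Kurzweil_Integration.integral_cong)
    fix s assume "s \<in> {0..a}"
    then show "T (a + r - s) (g s) = T r (T (a - s) (g s))"
      using C0_semigroupD(2)[OF assms(1), of r "a - s"] assms(4) by (simp add: algebra_simps)
  qed
  also have "\<dots> = T r (integral {0..a} (\<lambda>s. T (a - s) (g s)))"
    by (rule integral_blinfun_apply[OF integrable_continuous_real[OF c0]])
  finally have 1: "integral {0..a} (\<lambda>s. T (a + r - s) (g s)) = T r (integral {0..a} (\<lambda>s. T (a - s) (g s)))" .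
  have "((\<lambda>s. T (a + r - s) (g s)) has_integral integral {a..a + r} (\<lambda>s. T (a + r - s) (g s))) {a..a + r}"
    by (intro integrable_integral integrable_continuous_real continuous_on_subset[OF c])
      (use assms(3) in auto)
  from has_integral_shift_real_ivl[OF this, of a]
  have "((\<lambda>s. T (r - s) (g (a + s))) has_integral integral {a..a + r} (\<lambda>s. T (a + r - s) (g s))) {0..r}"
    by (simp add: algebra_simps)
  then have 2: "integral {a..a + r} (\<lambda>s. T (a + r - s) (g s)) = integral {0..r} (\<lambda>s. T (r - s) (g (a + s)))"
    by (simp add: integral_unique)
  have "integral {0..a} (\<lambda>s. T (a + r - s) (g s)) + integral {a..a + r} (\<lambda>s. T (a + r - s) (g s))
      = integral {0..a + r} (\<lambda>s. T (a + r - s) (g s))"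
    by (rule Henstock_Kurzweil_Integration.integral_combine)
      (use assms(3,4) integrable_continuous_real[OF c] in auto)
  then show ?thesis by (simp add: 1 2)
qed

section \<open>Exponential weights and a Gronwall argument\<close>

lemma has_integral_exp_scaled:
  fixes k t :: real
  assumes "0 < k" "0 \<le> t"
  shows "((\<lambda>s. exp (k * s)) has_integral (exp (k * t) - 1) / k) {0..t}"
proof -
  have "((\<lambda>s. exp (k * s)) has_integral exp (k * t) / k - exp (k * 0) / k) {0..t}"
  proof (rule fundamental_theorem_of_calculus[OF assms(2)])
    fix x
    have "((\<lambda>s. exp (k * s) / k) has_real_derivative exp (k * x)) (at x within {0..t})"
      using assms(1) by (auto intro!: derivative_eq_intros)
    then show "((\<lambda>s. exp (k * s) / k) has_vector_derivative exp (k * x)) (at x within {0..t})"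
      by (simp add: has_real_derivative_iff_has_vector_derivative)
  qed
  then show ?thesis by (simp add: diff_divide_distrib)
qed

text \<open>Gronwall's lemma without a constant term. At a point b where
  \<open>exp (- k * s) * d s\<close> is largest, the inequality yields k d(b) \<le> C d(b); since k
  = C + 1 this forces the maximum to vanish.\<close>

lemma integral_inequality_eq_0:
  fixes d :: "real \<Rightarrow> real"
  assumes "continuous_on {0..\<tau>} d" "0 \<le> C"
    and d: "\<And>t. t \<in> {0..\<tau>} \<Longrightarrow> 0 \<le> d t" "\<And>t. t \<in> {0..\<tau>} \<Longrightarrow> d t \<le> C * integral {0..t} d"
    and t: "t \<in> {0..\<tau>}"
  shows "d t = 0"
proof -
  define k where "k = C + 1"
  have k: "0 < k" using assms(2) by (simp add: k_def)
  have "\<exists>b\<in>{0..\<tau>}. \<forall>s\<in>{0..\<tau>}. exp (- k * s) * d s \<le> exp (- k * b) * d b"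
    by (intro continuous_attains_sup continuous_intros assms(1)) (use t in auto)
  then obtain b where b: "b \<in> {0..\<tau>}" "\<And>s. s \<in> {0..\<tau>} \<Longrightarrow> exp (- k * s) * d s \<le> exp (- k * b) * d b"
    by blast
  define m where "m = exp (- k * b) * d b"
  have m: "0 \<le> m" using d(1)[OF b(1)] by (simp add: m_def)
  have le: "d s \<le> m * exp (k * s)" if "s \<in> {0..\<tau>}" for s
  proof -
    have "exp (k * s) * (exp (- k * s) * d s) \<le> exp (k * s) * m"
      using b(2)[OF that] by (intro mult_left_mono) (auto simp: m_def)
    then show ?thesis by (simp add: mult.assoc[symmetric] exp_minus field_simps)
  qed
  have e: "((\<lambda>s. m * exp (k * s)) has_integral m * ((exp (k * b) - 1) / k)) {0..b}"
    by (rule has_integral_mult_right[OF has_integral_exp_scaled[OF k]]) (use b in auto)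
  have "integral {0..b} d \<le> m * ((exp (k * b) - 1) / k)"
    unfolding integral_unique[OF e, symmetric]
    by (intro integral_le integrable_continuous_real continuous_on_subset[OF assms(1)]
        has_integral_integrable[OF e] le) (use b in auto)
  also have "\<dots> \<le> m * (exp (k * b) / k)"
    using m k by (intro mult_left_mono divide_right_mono) auto
  also have "\<dots> = d b / k" by (simp add: m_def exp_minus)
  finally have "C * integral {0..b} d \<le> C * (d b / k)" using assms(2) by (intro mult_left_mono)
  then have "d b \<le> C * (d b / k)" using d(2)[OF b(1)] by simp
  then have "d b * k \<le> C * d b" using k by (simp add: field_simps)
  then have "d b \<le> 0" by (simp add: k_def algebra_simps)
  then have "m = 0" using d(1)[OF b(1)] by (simp add: m_def)
  then show ?thesis using le[OF t] d(1)[OF t] by simp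
qed

subsection \<open>Mild solutions\<close>

lemma ex_fixed_point_Volterra:
  fixes F :: "real \<Rightarrow> 'x::banach \<Rightarrow> 'x"
  assumes T: "C0_semigroup T" and "0 \<le> \<tau>" "0 < L"
    and F: "\<And>x. continuous_on {0..\<tau>} x \<Longrightarrow> continuous_on {0..\<tau>} (\<lambda>s. F s (x s))"
    and lip: "\<And>s x y. s \<in> {0..\<tau>} \<Longrightarrow> norm (F s y - F s x) \<le> L * norm (y - x)"
  shows "\<exists>x. continuous_on {0..\<tau>} x \<and>
    (\<forall>t\<in>{0..\<tau>}. x t = T t x0 + integral {0..t} (\<lambda>s. T (t - s) (F s (x s))))"
proof -
  obtain M where M: "0 < M" "\<And>t. t \<in> {0..\<tau>} \<Longrightarrow> norm (T t) \<le> M"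
    using C0_semigroup_locally_bounded[OF T] by blast
  \<comment> \<open>With the weight \<open>exp (k * s)\<close> the integral operator is a contraction on the whole interval.\<close>
  define k where "k = 2 * M * L"
  have k: "0 < k" using M assms(3) by (simp add: k_def)
  \<comment> \<open>The unknown is the weighted function z(s) = exp(- k s) x(s), so that the plain
    supremum norm is the weighted one. \<open>E\<close> removes the weight, and \<open>G\<close> is
    the integral operator in the weighted variable.\<close>
  define E where "E z s = exp (k * s) *\<^sub>R apply_bcontfun z s" for z :: "real \<Rightarrow>\<^sub>C 'x" and s
  define G where "G z t = exp (- k * t) *\<^sub>R (T t x0 + integral {0..t} (\<lambda>s. T (t - s) (F s (E z s))))"
    for z t
  \<comment> \<open>Clamping time to [0,\<tau>] turns functions on the interval into bounded
    continuous functions on the whole line, a complete metric space.\<close>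
  define c where "c t = max 0 (min \<tau> t)" for t
  define \<Phi> where "\<Phi> z = Bcontfun (\<lambda>t. G z (c t))" for z
  have Ec: "continuous_on {0..\<tau>} (E z)" for z
    unfolding E_def by (intro continuous_intros continuous_on_apply_bcontfun)
  note FEc = F[OF Ec]
  have cr: "c t \<in> {0..\<tau>}" for t using assms(2) by (auto simp: c_def)
  have Gc: "continuous_on {0..\<tau>} (G z)" for z
    unfolding G_def
    by (intro continuous_intros continuous_on_C0_semigroup_convolution[OF T FEc]
        continuous_on_subset[OF C0_semigroup_orbit_continuous[OF T]]) auto
  have "(\<lambda>t. G z (c t)) \<in> bcontfun" for z
    unfolding bcontfun_def mem_Collect_eq
  proof
    show "continuous_on UNIV (\<lambda>t. G z (c t))"
      by (rule continuous_on_compose2[OF Gc])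
        (use cr in \<open>auto simp: c_def[abs_def] intro!: continuous_intros\<close>)
    have "bounded (G z ` {0..\<tau>})"
      by (intro compact_imp_bounded compact_continuous_image Gc) simp
    then show "bounded (range (\<lambda>t. G z (c t)))"
      by (rule bounded_subset) (use cr in auto)
  qed
  then have \<Phi>: "apply_bcontfun (\<Phi> z) t = G z (c t)" for z t
    by (simp add: \<Phi>_def Bcontfun_inverse)
  have contr: "dist (G z t) (G w t) \<le> 1 / 2 * dist z w" if t: "t \<in> {0..\<tau>}" for z w t
  proof -
    have sub: "{0..t} \<subseteq> {0..\<tau>}" using t by auto
    have i: "(\<lambda>s. T (t - s) (F s (E z s))) integrable_on {0..t}" for z
      by (intro integrable_continuous_real continuous_on_C0_semigroup_convolution_integrand[OF T]
          continuous_on_subset[OF FEc sub]) simp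
    have e: "((\<lambda>s. M * L * dist z w * exp (k * s)) has_integral
        M * L * dist z w * ((exp (k * t) - 1) / k)) {0..t}"
      by (rule has_integral_mult_right[OF has_integral_exp_scaled[OF k]]) (use t in auto)
    have "norm (integral {0..t} (\<lambda>s. T (t - s) (F s (E z s)) - T (t - s) (F s (E w s))))
      \<le> integral {0..t} (\<lambda>s. M * L * dist z w * exp (k * s))"
    proof (rule Henstock_Kurzweil_Integration.integral_norm_bound_integral)
      fix s assume s: "s \<in> {0..t}"
      have "norm (T (t - s) (F s (E z s)) - T (t - s) (F s (E w s)))
          \<le> norm (T (t - s)) * norm (F s (E z s) - F s (E w s))"
        by (simp add: norm_blinfun flip: blinfun.diff_right)
      also have "\<dots> \<le> M * (L * norm (E z s - E w s))"
        using s t M(1) assms(3) by (intro mult_mono M(2) lip) auto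
      also have "norm (E z s - E w s) = exp (k * s) * dist (apply_bcontfun z s) (apply_bcontfun w s)"
        by (simp add: E_def dist_norm flip: scaleR_diff_right)
      also have "M * (L * \<dots>) \<le> M * (L * (exp (k * s) * dist z w))"
        using M(1) assms(3) by (intro mult_left_mono dist_bounded) auto
      finally show "norm (T (t - s) (F s (E z s)) - T (t - s) (F s (E w s)))
          \<le> M * L * dist z w * exp (k * s)" by (simp add: mult_ac)
    qed (use i has_integral_integrable[OF e] in \<open>auto intro: integrable_diff\<close>)
    \<comment> \<open>The choice of k makes M L / k equal to 1/2.\<close>
    also have "\<dots> = 1 / 2 * dist z w * (exp (k * t) - 1)"
      using M(1) assms(3) unfolding integral_unique[OF e] by (simp add: k_def field_simps)
    also have "\<dots> \<le> 1 / 2 * dist z w * exp (k * t)" by (intro mult_left_mono) auto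
    finally have n: "norm (integral {0..t} (\<lambda>s. T (t - s) (F s (E z s))) -
        integral {0..t} (\<lambda>s. T (t - s) (F s (E w s)))) \<le> 1 / 2 * dist z w * exp (k * t)"
      by (subst (asm) Henstock_Kurzweil_Integration.integral_diff[OF i i])
    have "dist (G z t) (G w t) = exp (- k * t) * norm (integral {0..t} (\<lambda>s. T (t - s) (F s (E z s))) -
        integral {0..t} (\<lambda>s. T (t - s) (F s (E w s))))"
      by (simp add: G_def dist_norm flip: scaleR_diff_right)
    also have "\<dots> \<le> exp (- k * t) * (1 / 2 * dist z w * exp (k * t))"
      using n by (intro mult_left_mono) auto
    finally show ?thesis by (simp add: exp_minus field_simps)
  qed
  have "\<exists>!z. \<Phi> z = z"
  proof (rule banach_fix_type[of "1 / 2"])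
    show "\<forall>z w. dist (\<Phi> z) (\<Phi> w) \<le> 1 / 2 * dist z w"
      by (intro allI dist_bound) (simp only: \<Phi> contr[OF cr])
  qed auto
  then obtain z where z: "\<Phi> z = z" by blast
  have "E z t = T t x0 + integral {0..t} (\<lambda>s. T (t - s) (F s (E z s)))" if t: "t \<in> {0..\<tau>}" for t
  proof -
    have "apply_bcontfun z t = G z t" using \<Phi>[of z t] z t by (simp add: c_def)
    then show ?thesis unfolding E_def[of z t] by (simp add: G_def exp_minus)
  qed
  then show ?thesis using Ec by blast
qed

section \<open>Radial truncation\<close>

definition radial_retraction :: "real \<Rightarrow> 'a::real_normed_vector \<Rightarrow> 'a" where
  "radial_retraction w x = (w / max w (norm x)) *\<^sub>R x"

lemma radial_retraction_id: "0 < w \<Longrightarrow> norm x \<le> w \<Longrightarrow> radial_retraction w x = x"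
  by (simp add: radial_retraction_def max_absorb1)

lemma norm_radial_retraction: "0 < w \<Longrightarrow> norm (radial_retraction w x) \<le> w"
  by (simp add: radial_retraction_def pos_divide_le_eq mult_left_mono less_max_iff_disj)

text \<open>The norm need not come from an inner product, so the retraction need not be
  nonexpansive. One multiple of \<open>norm (x - y)\<close> bounds the change of the vector, another
  the change of the scaling factor, as \<open>norm y \<le> n\<close> and the denominators differ by
  at most \<open>norm (x - y)\<close>.\<close>

lemma radial_retraction_lipschitz:
  assumes "0 < w"
  shows "norm (radial_retraction w x - radial_retraction w y) \<le> 2 * norm (x - y)"
proof -
  define m where "m = max w (norm x)"
  define n where "n = max w (norm y)"
  have m: "0 < m" "w \<le> m" and n: "0 < n" "norm y \<le> n" using assms by (auto simp: m_def n_def)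
  have mn: "\<bar>n - m\<bar> \<le> norm (x - y)"
    using norm_triangle_ineq3[of x y] by (auto simp: m_def n_def max_def abs_if split: if_splits)
  have "radial_retraction w x - radial_retraction w y
      = (w / m) *\<^sub>R (x - y) + (w / m * ((n - m) / n)) *\<^sub>R y"
    using m n by (simp add: radial_retraction_def m_def[symmetric] n_def[symmetric]
        scaleR_diff_right diff_divide_distrib right_diff_distrib scaleR_diff_left)
  also have "norm \<dots> \<le> w / m * norm (x - y) + w / m * (\<bar>n - m\<bar> / n) * norm y"
    using assms m n by (intro norm_triangle_le) (simp add: abs_mult)
  also have "\<dots> \<le> 1 * norm (x - y) + 1 * (\<bar>n - m\<bar> / n) * n"
    using assms m n by (intro add_mono mult_mono) auto
  also have "\<dots> \<le> 2 * norm (x - y)" using mn n by simp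
  finally show ?thesis .
qed

section \<open>Uniqueness, restarting and truncation for the semilinear equation\<close>

locale semilinear_system =
  fixes T :: "real \<Rightarrow> 'x \<Rightarrow>\<^sub>L 'x::banach" and f :: "'x \<Rightarrow> 'u::banach \<Rightarrow> 'x"
  assumes semigroup: "C0_semigroup T"
    and lipschitz: "lipschitz_on_bounded_sets f"
    and continuous_input: "\<And>x. continuous_on UNIV (f x)"
begin

lemma lipschitzE:
  obtains L where "0 < L"
    "\<And>x y v. norm x \<le> w \<Longrightarrow> norm y \<le> w \<Longrightarrow> norm (f y v - f x v) \<le> L * norm (y - x)"
proof -
  \<comment> \<open>The Lipschitz condition speaks of positive radii only; enlarging the radius
    admits every w.\<close>
  have "0 < max w 1" by simp
  then obtain L where "0 < L" "\<And>x y v. norm x \<le> max w 1 \<Longrightarrow> norm y \<le> max w 1 \<Longrightarrow>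
      norm (f y v - f x v) \<le> L * norm (y - x)"
    using lipschitz unfolding lipschitz_on_bounded_sets_def by blast
  then show ?thesis using that[of L] by (simp add: le_max_iff_disj)
qed

text \<open>Joint continuity of f is not a hypothesis; it results from separate continuity because
  the Lipschitz constant in the first argument is uniform in the second.\<close>

lemma continuous_on_rhs:
  assumes "continuous_on S x" "continuous_on S u"
  shows "continuous_on S (\<lambda>s. f (x s) (u s))"
  unfolding continuous_on_def
proof
  fix a assume a: "a \<in> S"
  let ?F = "at a within S"
  have x: "(x \<longlongrightarrow> x a) ?F" and u: "(u \<longlongrightarrow> u a) ?F"
    using assms a by (auto simp: continuous_on_def)
  obtain L where L: "\<And>y z v. norm y \<le> norm (x a) + 1 \<Longrightarrow> norm z \<le> norm (x a) + 1 \<Longrightarrow>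
      norm (f z v - f y v) \<le> L * norm (z - y)"
    using lipschitzE[of "norm (x a) + 1"] by metis
  have "((\<lambda>s. f (x s) (u s) - f (x a) (u s)) \<longlongrightarrow> 0) ?F"
  proof (rule Lim_null_comparison)
    have "((\<lambda>s. L * norm (x s - x a)) \<longlongrightarrow> L * norm (x a - x a)) ?F"
      by (intro tendsto_intros x)
    then show "((\<lambda>s. L * norm (x s - x a)) \<longlongrightarrow> 0) ?F" by simp
    have "eventually (\<lambda>s. norm (x s) < norm (x a) + 1) ?F"
      by (rule order_tendstoD(2)[OF tendsto_norm[OF x]]) simp
    then show "eventually (\<lambda>s. norm (f (x s) (u s) - f (x a) (u s)) \<le> L * norm (x s - x a)) ?F"
      by eventually_elim (rule L, auto)
  qed
  moreover have "((\<lambda>s. f (x a) (u s)) \<longlongrightarrow> f (x a) (u a)) ?F"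
    by (rule continuous_on_tendsto_compose[OF continuous_input u]) auto
  ultimately have "((\<lambda>s. (f (x s) (u s) - f (x a) (u s)) + f (x a) (u s)) \<longlongrightarrow> 0 + f (x a) (u a)) ?F"
    by (rule tendsto_add)
  then show "((\<lambda>s. f (x s) (u s)) \<longlongrightarrow> f (x a) (u a)) ?F" by simp
qed

lemma mild_solutionD:
  assumes "mild_solution T f u J x"
  shows "continuous_on J x"
    "t \<in> J \<Longrightarrow> x t = T t (x 0) + integral {0..t} (\<lambda>s. T (t - s) (f (x s) (u s)))"
  using assms unfolding mild_solution_def by blast+

lemma mild_solution_subset:
  "mild_solution T f u J x \<Longrightarrow> J' \<subseteq> J \<Longrightarrow> mild_solution T f u J' x"
  unfolding mild_solution_def using continuous_on_subset by blast

text \<open>On a compact interval both solutions stay in one ball, so a single Lipschitz constant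
  applies and the distance between them satisfies a homogeneous Gronwall inequality.\<close>

lemma mild_solution_unique:
  assumes "mild_solution T f u {0..\<tau>} x" "mild_solution T f u {0..\<tau>} y" "x 0 = y 0"
    and u: "continuous_on {0..\<tau>} u" and t: "t \<in> {0..\<tau>}"
  shows "x t = y t"
proof -
  note xc = mild_solutionD(1)[OF assms(1)] and yc = mild_solutionD(1)[OF assms(2)]
  obtain M where M: "0 < M" "\<And>t. t \<in> {0..\<tau>} \<Longrightarrow> norm (T t) \<le> M"
    using C0_semigroup_locally_bounded[OF semigroup] by blast
  have "bounded (x ` {0..\<tau>} \<union> y ` {0..\<tau>})"
    by (intro bounded_Un[THEN iffD2] conjI compact_imp_bounded compact_continuous_image xc yc) auto
  then obtain w where w: "\<And>z. z \<in> x ` {0..\<tau>} \<union> y ` {0..\<tau>} \<Longrightarrow> norm z \<le> w"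
    by (auto simp: bounded_iff)
  obtain L where L: "0 < L" "\<And>x y v. norm x \<le> w \<Longrightarrow> norm y \<le> w \<Longrightarrow> norm (f y v - f x v) \<le> L * norm (y - x)"
    using lipschitzE[of w] by metis
  have dc: "continuous_on {0..\<tau>} (\<lambda>s. norm (x s - y s))" by (intro continuous_intros xc yc)
  have "norm (x t - y t) = 0"
  proof (rule integral_inequality_eq_0[OF dc _ _ _ t, of "M * L"])
    fix t assume t: "t \<in> {0..\<tau>}"
    have sub: "{0..t} \<subseteq> {0..\<tau>}" using t by auto
    have i: "(\<lambda>s. T (t - s) (f (z s) (u s))) integrable_on {0..t}" if "continuous_on {0..\<tau>} z" for z
      by (intro integrable_continuous_real continuous_on_C0_semigroup_convolution_integrand[OF semigroup]
          continuous_on_subset[OF continuous_on_rhs[OF that u] sub]) simp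
    have "x t - y t = integral {0..t} (\<lambda>s. T (t - s) (f (x s) (u s)) - T (t - s) (f (y s) (u s)))"
      unfolding mild_solutionD(2)[OF assms(1) t] mild_solutionD(2)[OF assms(2) t]
      by (simp add: assms(3) Henstock_Kurzweil_Integration.integral_diff[OF i[OF xc] i[OF yc]])
    also have "norm \<dots> \<le> integral {0..t} (\<lambda>s. M * L * norm (x s - y s))"
    proof (rule Henstock_Kurzweil_Integration.integral_norm_bound_integral)
      show "(\<lambda>s. M * L * norm (x s - y s)) integrable_on {0..t}"
        by (intro integrable_continuous_real continuous_on_mult_left continuous_on_subset[OF dc sub])
      fix s assume s: "s \<in> {0..t}"
      have "norm (T (t - s) (f (x s) (u s)) - T (t - s) (f (y s) (u s)))
          \<le> norm (T (t - s)) * norm (f (x s) (u s) - f (y s) (u s))"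
        by (simp add: norm_blinfun flip: blinfun.diff_right)
      also have "\<dots> \<le> M * (L * norm (x s - y s))"
        using s t M(1) L(1) by (intro mult_mono M(2) L(2) w) auto
      finally show "norm (T (t - s) (f (x s) (u s)) - T (t - s) (f (y s) (u s))) \<le> M * L * norm (x s - y s)"
        by (simp add: mult.assoc)
    qed (intro integrable_diff i xc yc)
    also have "\<dots> = M * L * integral {0..t} (\<lambda>s. norm (x s - y s))" by simp
    finally show "norm (x t - y t) \<le> M * L * integral {0..t} (\<lambda>s. norm (x s - y s))" .
  qed (use M L in auto)
  then show ?thesis by simp
qed

lemma flow_eq:
  assumes "mild_solution T f u {0..t} x" "0 \<le> t" "continuous_on {0..t} u"
  shows "flow T f t (x 0) u = x t"
  unfolding flow_def
proof (rule the_equality)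
  fix y assume "\<exists>z. mild_solution T f u {0..t} z \<and> z 0 = x 0 \<and> z t = y"
  then obtain z where z: "mild_solution T f u {0..t} z" "z 0 = x 0" "z t = y" by blast
  show "y = x t" using mild_solution_unique[OF z(1) assms(1) z(2) assms(3), of t] assms(2) z(3) by simp
qed (use assms(1) in blast)

text \<open>\<open>Lie_derivative\<close> looks at solutions starting at time 0. Restarting at time
  a makes it applicable at every point of a trajectory.\<close>

lemma mild_solution_shift:
  assumes x: "mild_solution T f u {0..a + t} x" and a: "0 \<le> a" and u: "continuous_on {0..a + t} u"
  shows "mild_solution T f (\<lambda>s. u (a + s)) {0..t} (\<lambda>s. x (a + s))"
  unfolding mild_solution_def
proof
  note xc = mild_solutionD(1)[OF x]
  show "continuous_on {0..t} (\<lambda>s. x (a + s))"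
    by (rule continuous_on_compose2[OF xc]) (use a in \<open>auto intro!: continuous_intros\<close>)
  show "\<forall>r\<in>{0..t}. x (a + r) = T r (x (a + 0)) + integral {0..r} (\<lambda>s. T (r - s) (f (x (a + s)) (u (a + s))))"
  proof
    fix r assume r: "r \<in> {0..t}"
    have "continuous_on {0..a + r} (\<lambda>s. f (x s) (u s))"
      by (rule continuous_on_subset[OF continuous_on_rhs[OF xc u]]) (use r in auto)
    from C0_semigroup_convolution_split[OF semigroup this a] r
    have "integral {0..a + r} (\<lambda>s. T (a + r - s) (f (x s) (u s))) =
      T r (integral {0..a} (\<lambda>s. T (a - s) (f (x s) (u s)))) +
      integral {0..r} (\<lambda>s. T (r - s) (f (x (a + s)) (u (a + s))))" by simp
    moreover have "T (a + r) = T r o\<^sub>L T a"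
      using C0_semigroupD(2)[OF semigroup, of r a] r a by (simp add: add.commute)
    moreover have "x (a + r) = T (a + r) (x 0) + integral {0..a + r} (\<lambda>s. T (a + r - s) (f (x s) (u s)))"
      "x a = T a (x 0) + integral {0..a} (\<lambda>s. T (a - s) (f (x s) (u s)))"
      using r a by (auto intro: mild_solutionD(2)[OF x])
    ultimately have "x (a + r) = T r (T a (x 0) + integral {0..a} (\<lambda>s. T (a - s) (f (x s) (u s)))) +
        integral {0..r} (\<lambda>s. T (r - s) (f (x (a + s)) (u (a + s))))"
      by (simp only: blinfun.add_right add.assoc blinfun_apply_blinfun_compose)
    then show "x (a + r) = T r (x (a + 0)) +
        integral {0..r} (\<lambda>s. T (r - s) (f (x (a + s)) (u (a + s))))"
      by (simp only: add_0_right \<open>x a = T a (x 0) + _\<close>[symmetric])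
  qed
qed

text \<open>Composed with the retraction, f becomes globally Lipschitz in the state with constant 2
  L, so a solution exists on any prescribed interval at once and no continuation argument
  arises.\<close>

lemma ex_truncated_solution:
  assumes "0 \<le> \<tau>" "continuous_on {0..\<tau>} u" "0 < w"
  shows "\<exists>x. continuous_on {0..\<tau>} x \<and> x 0 = x0 \<and> (\<forall>t\<in>{0..\<tau>}.
    x t = T t x0 + integral {0..t} (\<lambda>s. T (t - s) (f (radial_retraction w (x s)) (u s))))"
proof -
  obtain L where L: "0 < L" "\<And>x y v. norm x \<le> w \<Longrightarrow> norm y \<le> w \<Longrightarrow> norm (f y v - f x v) \<le> L * norm (y - x)"
    using lipschitzE[of w] by metis
  have rc: "continuous_on S (radial_retraction w)" for S :: "'x set"
    by (rule lipschitz_on_continuous_on[of 2])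
      (auto intro!: lipschitz_onI simp: dist_norm radial_retraction_lipschitz[OF assms(3)])
  have "\<exists>x. continuous_on {0..\<tau>} x \<and>
    (\<forall>t\<in>{0..\<tau>}. x t = T t x0 + integral {0..t} (\<lambda>s. T (t - s) (f (radial_retraction w (x s)) (u s))))"
  proof (rule ex_fixed_point_Volterra[OF semigroup assms(1), of "L * 2"])
    show "continuous_on {0..\<tau>} (\<lambda>s. f (radial_retraction w (x s)) (u s))"
      if "continuous_on {0..\<tau>} x" for x
      by (intro continuous_on_rhs assms(2) continuous_on_compose2[OF rc[of UNIV] that]) auto
    fix s x y
    have "norm (f (radial_retraction w y) (u s) - f (radial_retraction w x) (u s))
        \<le> L * norm (radial_retraction w y - radial_retraction w x)"
      by (intro L(2) norm_radial_retraction assms(3))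
    also have "\<dots> \<le> L * (2 * norm (y - x))"
      using L(1) by (intro mult_left_mono radial_retraction_lipschitz assms(3)) auto
    finally show "norm (f (radial_retraction w y) (u s) - f (radial_retraction w x) (u s)) \<le> L * 2 * norm (y - x)"
      by simp
  qed (use L in auto)
  then obtain x where x: "continuous_on {0..\<tau>} x"
    "\<And>t. t \<in> {0..\<tau>} \<Longrightarrow> x t = T t x0 + integral {0..t} (\<lambda>s. T (t - s) (f (radial_retraction w (x s)) (u s)))"
    by blast
  moreover have "x 0 = x0" using C0_semigroupD(1)[OF semigroup] assms(1) by (subst x(2)) auto
  ultimately show ?thesis by blast
qed

end

subsection \<open>Integrated dissipation inequality and forward completeness\<close>

text \<open>Only an upper Dini bound is available, so the fundamental theorem does not apply to
  \<open>v\<close>. Subtracting the integral and a slope \<epsilon> gives \<open>w\<close>; consider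
  the last time at which \<open>w\<close> does not exceed its initial value. Before b,
  \<open>w\<close> would be smaller still slightly later, so that time is b.\<close>

lemma Dini_derivative_le_imp_le_integral:
  fixes v g :: "real \<Rightarrow> real"
  assumes "a \<le> b" and v: "continuous_on {a..b} v" and g: "continuous_on {a..b} g"
    and D: "\<And>s. s \<in> {a..<b} \<Longrightarrow>
      Limsup (at_right 0) (\<lambda>t. ereal (1 / t * (v (s + t) - v s))) \<le> ereal (g s)"
  shows "v b - v a \<le> integral {a..b} g"
proof (rule field_le_epsilon)
  fix e :: real assume e: "0 < e"
  \<comment> \<open>The summand 1 keeps the denominator positive when a = b.\<close>
  define \<epsilon> where "\<epsilon> = e / (b - a + 1)"
  have \<epsilon>: "0 < \<epsilon>" "\<epsilon> * (b - a) \<le> e" using e assms(1) by (simp_all add: \<epsilon>_def field_simps)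
  define G where "G t = integral {a..t} g" for t
  define w where "w t = v t - G t - \<epsilon> * (t - a)" for t
  have Gc: "continuous_on {a..b} G"
    unfolding G_def by (intro indefinite_integral_continuous_1 integrable_continuous_real g)
  have wc: "continuous_on {a..b} w" unfolding w_def by (intro continuous_intros v Gc)
  define S where "S = {t \<in> {a..b}. w t \<le> w a}"
  have "closed S" unfolding S_def
    by (intro continuous_on_closed_Collect_le wc continuous_on_const closed_atLeastAtMost)
  moreover have "bounded S" by (rule bounded_subset[of "{a..b}"]) (auto simp: S_def)
  ultimately have "compact S" by (simp add: compact_eq_bounded_closed)
  then obtain s where s: "s \<in> S" "\<And>t. t \<in> S \<Longrightarrow> t \<le> s"
    using compact_attains_sup[of S] assms(1) by (auto simp: S_def)
  have "s = b"
  proof (rule ccontr)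
    assume "s \<noteq> b"
    then have sb: "a \<le> s" "s < b" using s(1) by (auto simp: S_def)
    have "Limsup (at_right 0) (\<lambda>t. ereal (1 / t * (v (s + t) - v s))) < ereal (g s + \<epsilon> / 2)"
      using D[of s] sb \<epsilon>(1) by (auto intro: le_less_trans)
    from Limsup_lessD[OF this]
    obtain d1 where d1: "0 < d1" "\<And>t. 0 < t \<Longrightarrow> t < d1 \<Longrightarrow> 1 / t * (v (s + t) - v s) < g s + \<epsilon> / 2"
      by (auto simp: eventually_at_right_field)
    have "(G has_real_derivative g s) (at s within {a..b})"
      unfolding G_def by (rule integral_has_real_derivative[OF g]) (use sb in auto)
    then have "((\<lambda>y. (G y - G s) / (y - s)) \<longlongrightarrow> g s) (at s within {a..b})"
      by (simp add: has_field_derivative_iff)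
    then have "eventually (\<lambda>y. g s - \<epsilon> / 2 < (G y - G s) / (y - s)) (at s within {a..b})"
      by (rule order_tendstoD) (use \<epsilon>(1) in simp)
    then obtain d2 where d2: "0 < d2"
      "\<And>y. y \<in> {a..b} \<Longrightarrow> y \<noteq> s \<Longrightarrow> dist y s < d2 \<Longrightarrow> g s - \<epsilon> / 2 < (G y - G s) / (y - s)"
      by (auto simp: eventually_at)
    define t where "t = min (min d1 d2) (b - s) / 2"
    have t: "0 < t" "t < d1" "t < d2" "t < b - s" using d1(1) d2(1) sb by (auto simp: t_def)
    \<comment> \<open>Each difference quotient loses \<epsilon> / 2; together the losses are paid
      for by the slope \<epsilon> in \<open>w\<close>.\<close>
    have "v (s + t) - v s < (g s + \<epsilon> / 2) * t"
      using d1(2)[OF t(1,2)] t(1) by (simp add: field_simps)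
    moreover have "(g s - \<epsilon> / 2) * t < G (s + t) - G s"
      using d2(2)[of "s + t"] t sb by (simp add: dist_real_def pos_less_divide_eq)
    ultimately have "w (s + t) < w s" by (simp add: w_def algebra_simps)
    then have "s + t \<in> S" using s(1) t sb by (auto simp: S_def)
    then show False using s(2) t(1) by force
  qed
  then have "w b \<le> w a" using s(1) by (simp add: S_def)
  then show "v b - v a \<le> integral {a..b} g + e" using \<epsilon>(2) by (simp add: w_def G_def)
qed

section \<open>Bounded continuous inputs\<close>

lemma inputsD:
  assumes "u \<in> inputs"
  shows "continuous_on {0..} u" "bounded (u ` {0..})"
  using assms by (auto simp: inputs_def)

lemma inputs_shift:
  assumes "u \<in> inputs" "0 \<le> a"
  shows "(\<lambda>s. u (a + s)) \<in> inputs"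
  unfolding inputs_def mem_Collect_eq
proof
  show "continuous_on {0..} (\<lambda>s. u (a + s))"
    by (rule continuous_on_compose2[OF inputsD(1)[OF assms(1)]])
      (use assms(2) in \<open>auto intro!: continuous_intros\<close>)
  show "bounded ((\<lambda>s. u (a + s)) ` {0..})"
    by (rule bounded_subset[OF inputsD(2)[OF assms(1)]]) (use assms(2) in auto)
qed

lemma norm_le_input_norm:
  assumes "u \<in> inputs" "0 \<le> s"
  shows "norm (u s) \<le> input_norm u"
  unfolding input_norm_def
proof (rule cSUP_upper)
  show "bdd_above ((\<lambda>t. norm (u t)) ` {0..})"
    using inputsD(2)[OF assms(1)] by (auto simp: bounded_iff bdd_above_def)
qed (use assms(2) in simp)

lemma input_norm_nonneg: "u \<in> inputs \<Longrightarrow> 0 \<le> input_norm u"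
  using norm_le_input_norm[of u 0] norm_ge_zero[of "u 0"] by linarith

lemma continuous_on_comparison_norm:
  assumes "continuous_on {0..} \<gamma>" "continuous_on S x"
  shows "continuous_on S (\<lambda>s. \<gamma> (norm (x s)))"
  by (rule continuous_on_compose2[OF assms(1) continuous_on_norm[OF assms(2)]]) auto

lemma dissipatesE:
  assumes "dissipates T f V \<alpha> \<sigma>"
  obtains \<psi>1 \<psi>2 where "\<psi>1 \<in> class_K_inf" "\<psi>2 \<in> class_K_inf" "continuous_on UNIV V" "\<And>x. 0 \<le> V x"
    "\<And>x. \<psi>1 (norm x) \<le> V x" "\<And>x. V x \<le> \<psi>2 (norm x)"
    "\<And>x u. u \<in> inputs \<Longrightarrow> Lie_derivative T f V u x \<le> ereal (- \<alpha> (norm x) + \<sigma> (norm (u 0)))"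
  using assms unfolding dissipates_def by blast

context semilinear_system
begin

lemma dissipation_inequality:
  assumes diss: "dissipates T f V \<alpha> \<sigma>" and \<alpha>: "\<alpha> \<in> class_P" and \<sigma>: "\<sigma> \<in> class_K"
    and x: "mild_solution T f u {0..\<tau>} x" and u: "u \<in> inputs" and ab: "0 \<le> a" "a \<le> b" "b \<le> \<tau>"
  shows "V (x b) + integral {a..b} (\<lambda>s. \<alpha> (norm (x s))) \<le> V (x a) + integral {a..b} (\<lambda>s. \<sigma> (norm (u s)))"
proof -
  obtain \<psi>1 \<psi>2 where V: "continuous_on UNIV V"
    "\<And>x u. u \<in> inputs \<Longrightarrow> Lie_derivative T f V u x \<le> ereal (- \<alpha> (norm x) + \<sigma> (norm (u 0)))"
    using dissipatesE[OF diss] by metis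
  have sub: "{a..b} \<subseteq> {0..\<tau>}" using ab by auto
  have xc: "continuous_on {a..b} x" by (rule continuous_on_subset[OF mild_solutionD(1)[OF x] sub])
  have uc: "continuous_on {a..b} u" by (rule continuous_on_subset[OF inputsD(1)[OF u]]) (use ab in auto)
  have \<alpha>c: "continuous_on {a..b} (\<lambda>s. \<alpha> (norm (x s)))"
    by (rule continuous_on_comparison_norm[OF _ xc]) (use \<alpha> in \<open>simp add: class_P_def\<close>)
  have \<sigma>c: "continuous_on {a..b} (\<lambda>s. \<sigma> (norm (u s)))"
    by (rule continuous_on_comparison_norm[OF class_KD(1)[OF \<sigma>] uc])
  have "V (x b) - V (x a) \<le> integral {a..b} (\<lambda>s. - \<alpha> (norm (x s)) + \<sigma> (norm (u s)))"
  proof (rule Dini_derivative_le_imp_le_integral[of a b "\<lambda>s. V (x s)", OF ab(2)])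
    show "continuous_on {a..b} (\<lambda>s. V (x s))" by (rule continuous_on_compose2[OF V(1) xc]) auto
    show "continuous_on {a..b} (\<lambda>s. - \<alpha> (norm (x s)) + \<sigma> (norm (u s)))"
      by (intro continuous_on_add continuous_on_minus \<alpha>c \<sigma>c)
    fix s assume s: "s \<in> {a..<b}"
    let ?u = "\<lambda>r. u (s + r)"
    \<comment> \<open>The restarted trajectory is the flow from \<open>x s\<close> under the shifted
      input, as long as s + t < b; for an upper limit at 0 this suffices.\<close>
    have "eventually (\<lambda>t. ereal (1 / t * (V (x (s + t)) - V (x s))) =
        ereal (1 / t * (V (flow T f t (x s) ?u) - V (x s)))) (at_right 0)"
      unfolding eventually_at_right_field
    proof (intro exI[of _ "b - s"] conjI allI impI)
      fix t assume t: "0 < t" "t < b - s"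
      have x': "mild_solution T f u {0..s + t} x"
        by (rule mild_solution_subset[OF x]) (use s t ab in auto)
      have "mild_solution T f ?u {0..t} (\<lambda>r. x (s + r))"
        by (rule mild_solution_shift[OF x'])
          (use s ab in \<open>auto intro: continuous_on_subset[OF inputsD(1)[OF u]]\<close>)
      moreover have "continuous_on {0..t} ?u"
        by (rule continuous_on_subset[OF inputsD(1)[OF inputs_shift[OF u]]]) (use s ab in auto)
      ultimately have "flow T f t (x (s + 0)) ?u = x (s + t)"
        using flow_eq t(1) by (meson less_imp_le)
      then show "ereal (1 / t * (V (x (s + t)) - V (x s))) =
        ereal (1 / t * (V (flow T f t (x s) ?u) - V (x s)))" by simp
    qed (use s in auto)
    from Limsup_eq[OF this]
    have "Limsup (at_right 0) (\<lambda>t. ereal (1 / t * (V (x (s + t)) - V (x s)))) = Lie_derivative T f V ?u (x s)"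
      by (simp add: Lie_derivative_def)
    also have "\<dots> \<le> ereal (- \<alpha> (norm (x s)) + \<sigma> (norm (?u 0)))"
      by (rule V(2)[OF inputs_shift[OF u]]) (use s ab in auto)
    finally show "Limsup (at_right 0) (\<lambda>t. ereal (1 / t * (V (x (s + t)) - V (x s))))
        \<le> ereal (- \<alpha> (norm (x s)) + \<sigma> (norm (u s)))" by simp
  qed
  also have "\<dots> = - integral {a..b} (\<lambda>s. \<alpha> (norm (x s))) + integral {a..b} (\<lambda>s. \<sigma> (norm (u s)))"
    by (subst Henstock_Kurzweil_Integration.integral_add)
      (auto intro!: integrable_continuous_real continuous_on_minus \<alpha>c \<sigma>c)
  finally show ?thesis by simp
qed

lemma dissipation_bound:
  assumes diss: "dissipates T f V \<alpha> \<sigma>" and \<alpha>: "\<alpha> \<in> class_P" and \<sigma>: "\<sigma> \<in> class_K"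
    and x: "mild_solution T f u {0..t} x" and u: "u \<in> inputs" and t: "0 \<le> t"
  shows "V (x t) \<le> V (x 0) + t * \<sigma> (input_norm u)"
proof -
  have \<alpha>c: "continuous_on {0..t} (\<lambda>s. \<alpha> (norm (x s)))"
    by (rule continuous_on_comparison_norm[OF _ mild_solutionD(1)[OF x]])
      (use \<alpha> in \<open>simp add: class_P_def\<close>)
  have "continuous_on {0..t} u" by (rule continuous_on_subset[OF inputsD(1)[OF u]]) auto
  note \<sigma>c = continuous_on_comparison_norm[OF class_KD(1)[OF \<sigma>] this]
  have "0 \<le> integral {0..t} (\<lambda>s. \<alpha> (norm (x s)))"
    by (rule Henstock_Kurzweil_Integration.integral_nonneg[OF integrable_continuous_real[OF \<alpha>c]])
      (simp add: class_P_nonneg[OF \<alpha>])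
  moreover have "integral {0..t} (\<lambda>s. \<sigma> (norm (u s))) \<le> integral {0..t} (\<lambda>s. \<sigma> (input_norm u))"
  proof (rule integral_le[OF integrable_continuous_real[OF \<sigma>c]])
    fix s assume "s \<in> {0..t}"
    then show "\<sigma> (norm (u s)) \<le> \<sigma> (input_norm u)"
      by (intro class_K_mono[OF \<sigma>] norm_le_input_norm[OF u]) auto
  qed (rule integrable_const_ivl)
  ultimately show ?thesis
    using dissipation_inequality[OF diss \<alpha> \<sigma> x u order_refl t order_refl] t by simp
qed

text \<open>The radius R is chosen with \<open>\<psi>1 R\<close> above the bound B valid for V on
  all of [0,\<tau>]. Up to its first arrival at the sphere of radius R the truncated solution solves
  the original equation, hence V \<le> B there; but on the sphere V \<ge>
  \<open>\<psi>1 R\<close>.\<close>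

lemma ex_mild_solution_Icc:
  assumes diss: "dissipates T f V \<alpha> \<sigma>" and \<alpha>: "\<alpha> \<in> class_P" and \<sigma>: "\<sigma> \<in> class_K"
    and u: "u \<in> inputs" and \<tau>: "0 \<le> \<tau>"
  shows "\<exists>x. mild_solution T f u {0..\<tau>} x \<and> x 0 = x0"
proof -
  obtain \<psi>1 where \<psi>1: "\<psi>1 \<in> class_K_inf" and V: "\<And>x. 0 \<le> V x" "\<And>x. \<psi>1 (norm x) \<le> V x"
    using dissipatesE[OF diss] by metis
  note K = class_K_inf_imp_K[OF \<psi>1]
  define B where "B = V x0 + \<tau> * \<sigma> (input_norm u)"
  have \<sigma>u: "0 \<le> \<sigma> (input_norm u)" by (rule class_K_nonneg[OF \<sigma> input_norm_nonneg[OF u]])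
  obtain R where R: "0 \<le> R" "B < \<psi>1 R" using class_K_inf_unbounded[OF \<psi>1] .
  have B: "V x0 \<le> B" using \<tau> \<sigma>u by (simp add: B_def)
  have Rpos: "0 < R" using R B V(1)[of x0] class_KD(2)[OF K] by (cases "R = 0") auto
  have x0: "norm x0 < R"
  proof (rule ccontr)
    assume "\<not> ?thesis"
    then have "\<psi>1 R \<le> \<psi>1 (norm x0)" using class_K_mono[OF K R(1)] by simp
    then show False using R(2) B V(2)[of x0] by linarith
  qed
  have uc: "continuous_on {0..t} u" for t by (rule continuous_on_subset[OF inputsD(1)[OF u]]) auto
  obtain x where x: "continuous_on {0..\<tau>} x" "x 0 = x0"
    and eq: "\<And>t. t \<in> {0..\<tau>} \<Longrightarrow>
      x t = T t x0 + integral {0..t} (\<lambda>s. T (t - s) (f (radial_retraction R (x s)) (u s)))"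
    using ex_truncated_solution[OF \<tau> uc Rpos, of x0] by blast
  have mild: "mild_solution T f u {0..t} x"
    if t: "t \<le> \<tau>" and le: "\<And>s. s \<in> {0..t} \<Longrightarrow> norm (x s) \<le> R" for t
    unfolding mild_solution_def
  proof (intro conjI ballI)
    show "continuous_on {0..t} x" by (rule continuous_on_subset[OF x(1)]) (use t in auto)
    fix r assume r: "r \<in> {0..t}"
    have "x r = T r x0 + integral {0..r} (\<lambda>s. T (r - s) (f (radial_retraction R (x s)) (u s)))"
      by (rule eq) (use r t in auto)
    also have "integral {0..r} (\<lambda>s. T (r - s) (f (radial_retraction R (x s)) (u s))) =
        integral {0..r} (\<lambda>s. T (r - s) (f (x s) (u s)))"
    proof (rule Henstock_Kurzweil_Integration.integral_cong)
      fix s assume "s \<in> {0..r}"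
      then have "norm (x s) \<le> R" using le r by auto
      then show "T (r - s) (f (radial_retraction R (x s)) (u s)) = T (r - s) (f (x s) (u s))"
        by (simp only: radial_retraction_id[OF Rpos])
    qed
    finally show "x r = T r (x 0) + integral {0..r} (\<lambda>s. T (r - s) (f (x s) (u s)))"
      by (simp only: x(2))
  qed
  have nc: "continuous_on {0..t} (\<lambda>s. norm (x s))" if "t \<le> \<tau>" for t
    by (intro continuous_on_norm continuous_on_subset[OF x(1)]) (use that in auto)
  have "norm (x t) < R" if t: "t \<in> {0..\<tau>}" for t
  proof (rule ccontr)
    assume n: "\<not> ?thesis"
    \<comment> \<open>The times on the sphere form a compact set, so a first arrival time exists;
      the intermediate value theorem shows that the ball cannot be left earlier.\<close>
    define C where "C = {s \<in> {0..\<tau>}. norm (x s) = R}"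
    have hit: "\<exists>s\<in>C. s \<le> r" if r: "r \<in> {0..\<tau>}" "R \<le> norm (x r)" for r
    proof -
      have "\<exists>s\<ge>0. s \<le> r \<and> norm (x s) = R"
        by (rule IVT') (use r x0 x(2) nc in auto)
      then show ?thesis using r by (auto simp: C_def)
    qed
    have "closed C" unfolding C_def by (rule continuous_closed_preimage_constant[OF nc]) auto
    moreover have "bounded C" by (rule bounded_subset[of "{0..\<tau>}"]) (auto simp: C_def)
    ultimately have "compact C" by (simp add: compact_eq_bounded_closed)
    moreover have "C \<noteq> {}" using hit[OF t] n by auto
    ultimately obtain t1 where t1: "t1 \<in> C" "\<And>s. s \<in> C \<Longrightarrow> t1 \<le> s"
      using compact_attains_inf[of C] by blast
    have t1': "0 \<le> t1" "t1 \<le> \<tau>" "norm (x t1) = R" using t1(1) by (auto simp: C_def)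
    have "norm (x s) \<le> R" if s: "s \<in> {0..t1}" for s
    proof (rule ccontr)
      assume n: "\<not> norm (x s) \<le> R"
      then obtain r where "r \<in> C" "r \<le> s" using hit[of s] s t1' by auto
      then have "s = t1" using t1(2)[of r] s by auto
      then show False using n t1'(3) by simp
    qed
    then have m: "mild_solution T f u {0..t1} x" by (rule mild[OF t1'(2)])
    have "\<psi>1 R \<le> V (x t1)" using V(2)[of "x t1"] t1'(3) by simp
    also have "\<dots> \<le> V x0 + t1 * \<sigma> (input_norm u)"
      using dissipation_bound[OF diss \<alpha> \<sigma> m u t1'(1)] x(2) by simp
    also have "\<dots> \<le> B" unfolding B_def using t1' \<sigma>u by (simp add: mult_right_mono)
    finally show False using R(2) by simp
  qed
  then show ?thesis using mild[of \<tau>] x(2) by (auto intro: less_imp_le)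
qed

text \<open>By uniqueness the solutions on the intervals [0,\<tau>] agree where they overlap, and
  \<open>flow\<close> glues them together.\<close>

lemma forward_completeI:
  assumes ex: "\<And>x0 u \<tau>. u \<in> inputs \<Longrightarrow> 0 \<le> \<tau> \<Longrightarrow> \<exists>x. mild_solution T f u {0..\<tau>} x \<and> x 0 = x0"
  shows "forward_complete T f"
  unfolding forward_complete_def
proof (intro allI ballI)
  fix x0 :: 'x and u :: "real \<Rightarrow> 'u" assume u: "u \<in> inputs"
  have uc: "continuous_on {0..t} u" for t by (rule continuous_on_subset[OF inputsD(1)[OF u]]) auto
  define X where "X t = flow T f t x0 u" for t
  have X: "\<exists>x. mild_solution T f u {0..\<tau>} x \<and> x 0 = x0 \<and> (\<forall>t\<in>{0..\<tau>}. X t = x t)" if \<tau>: "0 \<le> \<tau>" for \<tau>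
  proof -
    obtain x where x: "mild_solution T f u {0..\<tau>} x" "x 0 = x0" using ex[OF u \<tau>] by blast
    have "X t = x t" if "t \<in> {0..\<tau>}" for t
      using flow_eq[OF mild_solution_subset[OF x(1)] _ uc, of t] that x(2) by (auto simp: X_def)
    then show ?thesis using x by blast
  qed
  have X0: "X 0 = x0" using X[of 0] by auto
  have "mild_solution T f u {0..} X"
    unfolding mild_solution_def
  proof (intro conjI ballI)
    show "continuous_on {0..} X"
      unfolding continuous_on_eq_continuous_within
    proof
      fix t :: real assume t: "t \<in> {0..}"
      obtain x where x: "mild_solution T f u {0..t + 1} x" "\<forall>s\<in>{0..t + 1}. X s = x s"
        using X[of "t + 1"] t by auto
      have "continuous_on {0..t + 1} X"
        using mild_solutionD(1)[OF x(1)] x(2) continuous_on_cong[OF refl, of "{0..t + 1}" X x] by blast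
      then have "continuous (at t within {0..t + 1}) X"
        using t by (auto simp: continuous_on_eq_continuous_within)
      \<comment> \<open>Continuity at t is local, so the solution on [0,t + 1] decides it; stopping
        at t would give left continuity only.\<close>
      moreover have "at t within {0..} = at t within {0..t + 1}"
        by (rule at_within_nhd[of t "{..<t + 1}"]) auto
      ultimately show "continuous (at t within {0..}) X" by simp
    qed
    fix t :: real assume t: "t \<in> {0..}"
    obtain x where x: "mild_solution T f u {0..t} x" "x 0 = x0" "\<And>s. s \<in> {0..t} \<Longrightarrow> X s = x s"
      using X[of t] t by auto
    have "X t = x t" using x(3)[of t] t by simp
    also have "\<dots> = T t (x 0) + integral {0..t} (\<lambda>s. T (t - s) (f (x s) (u s)))"
      by (rule mild_solutionD(2)[OF x(1)]) (use t in auto)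
    also have "integral {0..t} (\<lambda>s. T (t - s) (f (x s) (u s))) = integral {0..t} (\<lambda>s. T (t - s) (f (X s) (u s)))"
      by (rule Henstock_Kurzweil_Integration.integral_cong) (simp add: x(3))
    finally show "X t = T t (X 0) + integral {0..t} (\<lambda>s. T (t - s) (f (X s) (u s)))"
      by (simp only: X0 x(2))
  qed
  then show "\<exists>x. mild_solution T f u {0..} x \<and> x 0 = x0" using X0 by blast
qed

lemma dissipates_imp_forward_complete:
  assumes "dissipates T f V \<alpha> \<sigma>" "\<alpha> \<in> class_P" "\<sigma> \<in> class_K"
  shows "forward_complete T f"
  by (intro forward_completeI ex_mild_solution_Icc[OF assms])

lemma dissipates_obtain_solution:
  assumes "dissipates T f V \<alpha> \<sigma>" "\<alpha> \<in> class_P" "\<sigma> \<in> class_K" "u \<in> inputs" "0 \<le> t"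
  obtains x where "mild_solution T f u {0..t} x" "x 0 = x0" "flow T f t x0 u = x t"
proof -
  obtain x where x: "mild_solution T f u {0..t} x" "x 0 = x0"
    using ex_mild_solution_Icc[OF assms] by blast
  moreover have "flow T f t (x 0) u = x t"
    by (rule flow_eq[OF x(1) assms(5) continuous_on_subset[OF inputsD(1)[OF assms(4)]]]) auto
  ultimately show ?thesis using that by blast
qed

subsection \<open>Stability estimates\<close>

lemma dissipates_imp_iISS:
  assumes diss: "dissipates T f V \<alpha> \<sigma>" and \<alpha>: "\<alpha> \<in> class_P" and \<sigma>: "\<sigma> \<in> class_K"
  shows "iISS T f"
proof -
  obtain \<psi>1 \<psi>2 where \<psi>: "\<psi>1 \<in> class_K_inf" "\<psi>2 \<in> class_K_inf" and V: "\<And>x. 0 \<le> V x"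
    "\<And>x. \<psi>1 (norm x) \<le> V x" "\<And>x. V x \<le> \<psi>2 (norm x)"
    using dissipatesE[OF diss] by metis
  obtain \<phi> where \<phi>: "\<phi> \<in> class_K_inf" "\<And>r. 0 \<le> r \<Longrightarrow> \<phi> (\<psi>1 r) = r"
    using class_K_inf_inverse[OF \<psi>(1)] by metis
  note K = class_K_inf_imp_K[OF \<phi>(1)] class_K_inf_imp_K[OF \<psi>(2)]
  obtain \<beta> where \<beta>: "\<beta> \<in> class_KL"
    "\<And>a b t g. 0 \<le> a \<Longrightarrow> a \<le> b \<Longrightarrow> 0 \<le> t \<Longrightarrow> continuous_on {0..t} g \<Longrightarrow>
       (\<And>s. s \<in> {0..t} \<Longrightarrow> 0 \<le> g s \<and> a \<le> \<psi>2 (g s) \<and> \<psi>1 (g s) \<le> 2 * b) \<Longrightarrow>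
       integral {0..t} (\<lambda>s. \<alpha> (g s)) \<le> b \<Longrightarrow> a \<le> \<beta> b t"
    using class_KL_decay[OF \<alpha> \<psi>] by blast
  \<comment> \<open>One factor 2 comes from the bound
    \<open>V (x t) \<le> \<beta> (V x0) t + 2 * S t\<close>, the other from the weak triangle
    inequality for \<phi>.\<close>
  define \<theta> where "\<theta> r = \<phi> (4 * r)" for r
  have "\<exists>r\<ge>0. N < \<theta> r" for N
  proof -
    obtain r where "0 \<le> r" "N < \<phi> r" using class_K_inf_unbounded[OF \<phi>(1)] .
    then show ?thesis by (intro exI[of _ "r / 4"]) (simp add: \<theta>_def)
  qed
  then have \<theta>: "\<theta> \<in> class_K_inf"
    unfolding \<theta>_def by (intro class_K_infI class_K_scale[OF K(1)]) simp_all
  have B: "(\<lambda>r t. \<phi> (2 * \<beta> (\<psi>2 r) t)) \<in> class_KL"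
    using class_KL_compose[OF \<beta>(1) class_K_scale[OF K(1), of 2] K(2)] by simp
  have "norm (flow T f t x0 u) \<le> \<phi> (2 * \<beta> (\<psi>2 (norm x0)) t) + \<theta> (integral {0..t} (\<lambda>s. \<sigma> (norm (u s))))"
    if u: "u \<in> inputs" and t: "0 \<le> t" for x0 u t
  proof -
    obtain x where x: "mild_solution T f u {0..t} x" "x 0 = x0" "flow T f t x0 u = x t"
      using dissipates_obtain_solution[OF diss \<alpha> \<sigma> u t] by blast
    note xc = mild_solutionD(1)[OF x(1)]
    have \<alpha>c: "continuous_on {0..t} (\<lambda>s. \<alpha> (norm (x s)))"
      by (rule continuous_on_comparison_norm[OF _ xc]) (use \<alpha> in \<open>simp add: class_P_def\<close>)
    have "continuous_on {0..t} u" by (rule continuous_on_subset[OF inputsD(1)[OF u]]) auto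
    note \<sigma>c = continuous_on_comparison_norm[OF class_KD(1)[OF \<sigma>] this]
    define S where "S r = integral {0..r} (\<lambda>s. \<sigma> (norm (u s)))" for r
    have S0: "0 \<le> S r" if "r \<in> {0..t}" for r
      unfolding S_def
      by (rule Henstock_Kurzweil_Integration.integral_nonneg[OF integrable_continuous_real])
        (use that in \<open>auto intro: continuous_on_subset[OF \<sigma>c] class_K_nonneg[OF \<sigma>]\<close>)
    have ineq: "V (x b) + integral {a..b} (\<lambda>s. \<alpha> (norm (x s))) \<le> V (x a) + (S b - S a)"
      and \<alpha>nn: "0 \<le> integral {a..b} (\<lambda>s. \<alpha> (norm (x s)))"
      if ab: "0 \<le> a" "a \<le> b" "b \<le> t" for a b
    proof -
      have "S a + integral {a..b} (\<lambda>s. \<sigma> (norm (u s))) = S b"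
        unfolding S_def
        by (rule Henstock_Kurzweil_Integration.integral_combine[OF ab(1,2) integrable_continuous_real])
          (rule continuous_on_subset[OF \<sigma>c], use ab in auto)
      then show "V (x b) + integral {a..b} (\<lambda>s. \<alpha> (norm (x s))) \<le> V (x a) + (S b - S a)"
        using dissipation_inequality[OF diss \<alpha> \<sigma> x(1) u ab] by simp
      show "0 \<le> integral {a..b} (\<lambda>s. \<alpha> (norm (x s)))"
        by (rule Henstock_Kurzweil_Integration.integral_nonneg[OF integrable_continuous_real])
          (use ab in \<open>auto intro: continuous_on_subset[OF \<alpha>c] class_P_nonneg[OF \<alpha>]\<close>)
    qed
    have St: "0 \<le> S t" using S0[of t] t by simp
    have S00: "S 0 = 0" by (simp add: S_def)
    have \<beta>nn: "0 \<le> \<beta> (V x0) t" by (rule class_KL_nonneg[OF \<beta>(1) V(1) t])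
    have main: "V (x t) \<le> \<beta> (V x0) t + 2 * S t"
    proof (cases "V (x t) - S t \<le> S t")
      case True
      then show ?thesis using \<beta>nn by linarith
    next
      case False
      define a where "a = V (x t) - S t"
      have a: "S t < a" using False by (simp add: a_def)
      have "a \<le> \<beta> (V x0) t"
      proof (rule \<beta>(2)[OF _ _ t continuous_on_norm[OF xc]])
        show "0 \<le> a" using a St by linarith
        show aV: "a \<le> V x0" using ineq[of 0 t] \<alpha>nn[of 0 t] t x(2) S00 by (simp add: a_def)
        \<comment> \<open>As V(x t) = a + S(t), the input terms cancel in the dissipation inequality
          and leave at most V(x0) - a.\<close>
        show "integral {0..t} (\<lambda>s. \<alpha> (norm (x s))) \<le> V x0"
          using ineq[of 0 t] t x(2) S00 a St by (simp add: a_def)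
        \<comment> \<open>The factor 2 required by the decay estimate originates here: V(x s) \<le>
          V(x0) + S(s), and S(s) \<le> S(t) < a \<le> V(x0).\<close>
        fix s assume s: "s \<in> {0..t}"
        have "V (x t) \<le> V (x s) + (S t - S s)" using ineq[of s t] \<alpha>nn[of s t] s by auto
        then have "a \<le> V (x s)" using S0[OF s] by (simp add: a_def)
        moreover have "V (x s) \<le> V x0 + S s" using ineq[of 0 s] \<alpha>nn[of 0 s] s x(2) S00 by auto
        moreover have "S s \<le> S t"
        proof -
          have "S s + integral {s..t} (\<lambda>s. \<sigma> (norm (u s))) = S t"
            unfolding S_def
            by (rule Henstock_Kurzweil_Integration.integral_combine[OF _ _ integrable_continuous_real[OF \<sigma>c]])
              (use s in auto)
          moreover have "0 \<le> integral {s..t} (\<lambda>s. \<sigma> (norm (u s)))"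
            by (rule Henstock_Kurzweil_Integration.integral_nonneg[OF integrable_continuous_real])
              (use s in \<open>auto intro: continuous_on_subset[OF \<sigma>c] class_K_nonneg[OF \<sigma>]\<close>)
          ultimately show ?thesis by linarith
        qed
        ultimately show "0 \<le> norm (x s) \<and> a \<le> \<psi>2 (norm (x s)) \<and> \<psi>1 (norm (x s)) \<le> 2 * V x0"
          using V(2,3)[of "x s"] a aV by auto
      qed
      then show ?thesis using St by (simp add: a_def)
    qed
    have "\<beta> (V x0) t \<le> \<beta> (\<psi>2 (norm x0)) t"
      using \<beta>(1) t by (intro class_K_mono[of "\<lambda>r. \<beta> r t"] V) (auto simp: class_KL_def)
    with main have le: "\<psi>1 (norm (x t)) \<le> \<beta> (\<psi>2 (norm x0)) t + 2 * S t" using V(2)[of "x t"] by linarith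
    have "norm (x t) = \<phi> (\<psi>1 (norm (x t)))" by (simp add: \<phi>(2))
    also have "\<dots> \<le> \<phi> (\<beta> (\<psi>2 (norm x0)) t + 2 * S t)"
      by (rule class_K_mono[OF K(1) _ le]) (simp add: class_K_nonneg[OF class_K_inf_imp_K[OF \<psi>(1)]])
    also have "\<dots> \<le> \<phi> (2 * \<beta> (\<psi>2 (norm x0)) t) + \<phi> (2 * (2 * S t))"
      using St by (intro class_K_le_double[OF K(1)] class_KL_nonneg[OF \<beta>(1)] class_K_nonneg[OF K(2)] t) auto
    finally show ?thesis by (simp add: x(3) \<theta>_def S_def)
  qed
  then show ?thesis
    unfolding iISS_def
    by (intro conjI bexI[of _ \<theta>] bexI[of _ \<sigma>] bexI[OF _ B] allI ballI impI
        dissipates_imp_forward_complete[OF assms] \<theta> \<sigma>)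
qed

lemma dissipates_imp_ISS:
  assumes diss: "dissipates T f V \<alpha> \<sigma>" and \<alpha>: "\<alpha> \<in> class_P" and \<sigma>: "\<sigma> \<in> class_K"
    and ev: "\<And>c. 0 \<le> c \<Longrightarrow> eventually (\<lambda>r. \<sigma> c < \<alpha> r) at_top"
  shows "ISS T f"
proof -
  obtain \<psi>1 \<psi>2 where \<psi>: "\<psi>1 \<in> class_K_inf" "\<psi>2 \<in> class_K_inf" and V: "\<And>x. 0 \<le> V x"
    "\<And>x. \<psi>1 (norm x) \<le> V x" "\<And>x. V x \<le> \<psi>2 (norm x)" and Vc: "continuous_on UNIV V"
    using dissipatesE[OF diss] by metis
  obtain \<phi> where \<phi>: "\<phi> \<in> class_K_inf" "\<And>r. 0 \<le> r \<Longrightarrow> \<phi> (\<psi>1 r) = r"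
    using class_K_inf_inverse[OF \<psi>(1)] by metis
  obtain \<eta> where \<eta>: "\<eta> \<in> class_K_inf" "\<And>r. 0 < r \<Longrightarrow> \<sigma> (\<eta> r) < \<alpha> r"
    using class_K_inf_gain_below[OF \<alpha> \<sigma> ev] by blast
  obtain \<xi> where \<xi>: "\<xi> \<in> class_K_inf" "\<And>r. 0 \<le> r \<Longrightarrow> \<eta> (\<xi> r) = r"
    using class_K_inf_inverse[OF \<eta>(1)] by metis
  note K = class_K_inf_imp_K[OF \<phi>(1)] class_K_inf_imp_K[OF \<psi>(2)] class_K_inf_imp_K[OF \<eta>(1)]
    class_K_inf_imp_K[OF \<xi>(1)]
  note \<sigma>\<eta> = class_K_compose[OF \<sigma> K(3)]
  \<comment> \<open>The decay rate that survives the worst input permitted by the gain \<eta>;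
    \<eta> was built to keep it positive definite.\<close>
  define \<rho> where "\<rho> r = \<alpha> r - \<sigma> (\<eta> r)" for r
  have \<rho>: "\<rho> \<in> class_P"
    unfolding class_P_def mem_Collect_eq
  proof (intro conjI allI impI)
    show "continuous_on {0..} \<rho>" unfolding \<rho>_def
      by (intro continuous_on_diff class_KD(1)[OF \<sigma>\<eta>]) (use \<alpha> in \<open>simp add: class_P_def\<close>)
    show "\<rho> 0 = 0" using \<alpha> class_KD(2)[OF \<sigma>\<eta>] by (simp add: \<rho>_def class_P_def)
    show "0 < \<rho> r" if "0 < r" for r using \<eta>(2)[OF that] by (simp add: \<rho>_def)
  qed
  obtain \<beta> where \<beta>: "\<beta> \<in> class_KL"
    "\<And>a b t g. 0 \<le> a \<Longrightarrow> a \<le> b \<Longrightarrow> 0 \<le> t \<Longrightarrow> continuous_on {0..t} g \<Longrightarrow>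
       (\<And>s. s \<in> {0..t} \<Longrightarrow> 0 \<le> g s \<and> a \<le> \<psi>2 (g s) \<and> \<psi>1 (g s) \<le> 2 * b) \<Longrightarrow>
       integral {0..t} (\<lambda>s. \<rho> (g s)) \<le> b \<Longrightarrow> a \<le> \<beta> b t"
    using class_KL_decay[OF \<rho> \<psi>] by blast
  have B: "(\<lambda>r t. \<phi> (\<beta> (\<psi>2 r) t)) \<in> class_KL" by (rule class_KL_compose[OF \<beta>(1) K(1,2)])
  have \<Gamma>: "(\<lambda>c. \<phi> (\<psi>2 (\<xi> c))) \<in> class_K" by (rule class_K_compose[OF K(1) class_K_compose[OF K(2,4)]])
  have "norm (flow T f t x0 u) \<le> \<phi> (\<beta> (\<psi>2 (norm x0)) t) + \<phi> (\<psi>2 (\<xi> (input_norm u)))"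
    if u: "u \<in> inputs" and t: "0 \<le> t" for x0 u t
  proof -
    obtain x where x: "mild_solution T f u {0..t} x" "x 0 = x0" "flow T f t x0 u = x t"
      using dissipates_obtain_solution[OF diss \<alpha> \<sigma> u t] by blast
    note xc = mild_solutionD(1)[OF x(1)]
    have cont: "continuous_on {0..t} (\<lambda>s. \<gamma> (norm (x s)))" if "continuous_on {0..} \<gamma>" for \<gamma>
      by (rule continuous_on_comparison_norm[OF that xc])
    have "continuous_on {0..t} u" by (rule continuous_on_subset[OF inputsD(1)[OF u]]) auto
    note \<sigma>c = continuous_on_comparison_norm[OF class_KD(1)[OF \<sigma>] this]
    have \<alpha>c: "continuous_on {0..t} (\<lambda>s. \<alpha> (norm (x s)))"
      and \<rho>c: "continuous_on {0..t} (\<lambda>s. \<rho> (norm (x s)))"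
      using \<alpha> \<rho> by (auto intro: cont simp: class_P_def)
    define c where "c = input_norm u"
    have c: "0 \<le> c" unfolding c_def by (rule input_norm_nonneg[OF u])
    \<comment> \<open>The level of V above which the gain condition holds: V(x) \<ge> \<kappa>
      forces |x| \<ge> \<xi>(c), hence \<eta>(|x|) \<ge> c, which dominates the input.\<close>
    define \<kappa> where "\<kappa> = \<psi>2 (\<xi> c)"
    have gain: "\<sigma> (norm (u s)) \<le> \<sigma> (\<eta> (norm (x s)))" if s: "0 \<le> s" "\<kappa> \<le> V (x s)" for s
    proof -
      have "\<psi>2 (\<xi> c) \<le> \<psi>2 (norm (x s))" using s(2) V(3)[of "x s"] by (simp add: \<kappa>_def)
      then have "\<xi> c \<le> norm (x s)" by (rule class_K_le_cancel[OF K(2) norm_ge_zero])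
      then have "c \<le> \<eta> (norm (x s))"
        using class_K_mono[OF K(3) class_K_nonneg[OF K(4) c]] \<xi>(2)[OF c] by simp
      moreover have "norm (u s) \<le> c" unfolding c_def by (rule norm_le_input_norm[OF u s(1)])
      ultimately show ?thesis by (intro class_K_mono[OF \<sigma>]) auto
    qed
    have ineq: "V (x q) + integral {p..q} (\<lambda>s. \<rho> (norm (x s))) \<le> V (x p)"
      and dec: "V (x q) \<le> V (x p)"
      if pq: "0 \<le> p" "p \<le> q" "q \<le> t" "\<And>s. s \<in> {p..q} \<Longrightarrow> \<kappa> \<le> V (x s)" for p q
    proof -
      have sub: "{p..q} \<subseteq> {0..t}" using pq by auto
      have i\<alpha>: "(\<lambda>s. \<alpha> (norm (x s))) integrable_on {p..q}"
        and i\<sigma>: "(\<lambda>s. \<sigma> (norm (u s))) integrable_on {p..q}"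
        and i\<rho>: "(\<lambda>s. \<rho> (norm (x s))) integrable_on {p..q}"
        by (intro integrable_continuous_real continuous_on_subset[OF _ sub] \<alpha>c \<sigma>c \<rho>c)+
      have "integral {p..q} (\<lambda>s. \<rho> (norm (x s)))
          \<le> integral {p..q} (\<lambda>s. \<alpha> (norm (x s)) - \<sigma> (norm (u s)))"
      proof (rule integral_le[OF i\<rho> integrable_diff[OF i\<alpha> i\<sigma>]])
        fix s assume s: "s \<in> {p..q}"
        then have "0 \<le> s" using pq(1) by simp
        from gain[OF this pq(4)[OF s]]
        show "\<rho> (norm (x s)) \<le> \<alpha> (norm (x s)) - \<sigma> (norm (u s))" by (simp add: \<rho>_def)
      qed
      then show i: "V (x q) + integral {p..q} (\<lambda>s. \<rho> (norm (x s))) \<le> V (x p)"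
        using dissipation_inequality[OF diss \<alpha> \<sigma> x(1) u pq(1-3)]
        by (simp add: Henstock_Kurzweil_Integration.integral_diff[OF i\<alpha> i\<sigma>])
      have "0 \<le> integral {p..q} (\<lambda>s. \<rho> (norm (x s)))"
        by (rule Henstock_Kurzweil_Integration.integral_nonneg[OF i\<rho>]) (simp add: class_P_nonneg[OF \<rho>])
      then show "V (x q) \<le> V (x p)" using i by linarith
    qed
    have vc: "continuous_on {0..t} (\<lambda>s. V (x s))" by (rule continuous_on_compose2[OF Vc xc]) auto
    have main: "V (x t) \<le> \<beta> (V x0) t" if V\<kappa>: "\<kappa> < V (x t)"
    proof -
      \<comment> \<open>Once at or below \<kappa>, V stays there. Otherwise take the last time m
        with V = \<kappa>: on [m,t] the gain condition holds, so V cannot increase from \<kappa> to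
        its larger value at t.\<close>
      have above: "\<kappa> < V (x s)" if s: "s \<in> {0..t}" for s
      proof (rule ccontr)
        assume n: "\<not> \<kappa> < V (x s)"
        define C where "C = {r \<in> {0..t}. V (x r) = \<kappa>}"
        have hit: "\<exists>r'\<in>C. r \<le> r'" if r: "r \<in> {0..t}" "V (x r) \<le> \<kappa>" for r
        proof -
          have "\<exists>r'\<ge>r. r' \<le> t \<and> V (x r') = \<kappa>"
            by (rule IVT'[where f = "\<lambda>r. V (x r)", OF r(2) less_imp_le[OF V\<kappa>] _ continuous_on_subset[OF vc]])
              (use r(1) in auto)
          then obtain r' where r': "r \<le> r'" "r' \<le> t" "V (x r') = \<kappa>" by blast
          then have "r' \<in> C" using r(1) by (simp add: C_def)
          then show ?thesis using r'(1) by blast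
        qed
        have "closed C" unfolding C_def by (rule continuous_closed_preimage_constant[OF vc]) auto
        moreover have "bounded C" by (rule bounded_subset[of "{0..t}"]) (auto simp: C_def)
        ultimately have "compact C" by (simp add: compact_eq_bounded_closed)
        moreover have "C \<noteq> {}" using hit[OF s] n by auto
        ultimately obtain m where m: "m \<in> C" "\<And>r. r \<in> C \<Longrightarrow> r \<le> m"
          using compact_attains_sup[of C] by blast
        have m': "0 \<le> m" "m \<le> t" "V (x m) = \<kappa>" using m(1) by (auto simp: C_def)
        have "\<kappa> \<le> V (x r)" if r: "r \<in> {m..t}" for r
        proof (rule ccontr)
          assume n: "\<not> \<kappa> \<le> V (x r)"
          then obtain r' where "r' \<in> C" "r \<le> r'" using hit[of r] r m' by auto
          then have "r = m" using m(2)[of r'] r by auto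
          then show False using n m'(3) by simp
        qed
        from dec[OF m'(1,2) order_refl this] show False using V\<kappa> m'(3) by simp
      qed
      show ?thesis
      proof (rule \<beta>(2)[OF V(1) _ t continuous_on_norm[OF xc]])
        have le: "V (x q) \<le> V (x p)" if "0 \<le> p" "p \<le> q" "q \<le> t" for p q
          by (rule dec[OF that]) (use above that in \<open>auto intro!: less_imp_le\<close>)
        show "V (x t) \<le> V x0" using le[of 0 t] t x(2) by simp
        have "V (x t) + integral {0..t} (\<lambda>s. \<rho> (norm (x s))) \<le> V (x 0)"
          by (rule ineq) (use t above in \<open>auto intro!: less_imp_le\<close>)
        then show "integral {0..t} (\<lambda>s. \<rho> (norm (x s))) \<le> V x0" using x(2) V(1)[of "x t"] by simp
        fix s assume s: "s \<in> {0..t}"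
        have "V (x t) \<le> V (x s)" "V (x s) \<le> V x0" using le[of s t] le[of 0 s] s x(2) by auto
        then show "0 \<le> norm (x s) \<and> V (x t) \<le> \<psi>2 (norm (x s)) \<and> \<psi>1 (norm (x s)) \<le> 2 * V x0"
          using V(2,3)[of "x s"] V(1)[of x0] by auto
      qed
    qed
    have "\<beta> (V x0) t \<le> \<beta> (\<psi>2 (norm x0)) t"
      using \<beta>(1) t by (intro class_K_mono[of "\<lambda>r. \<beta> r t"] V) (auto simp: class_KL_def)
    \<comment> \<open>An alternative instead of a sum: below \<kappa> the gain alone bounds the
      state, above it the decay alone. Hence \<phi> can be applied without doubling its
      arguments.\<close>
    then have le: "\<psi>1 (norm (x t)) \<le> \<kappa> \<or> \<psi>1 (norm (x t)) \<le> \<beta> (\<psi>2 (norm x0)) t"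
      using V(2)[of "x t"] main by linarith
    have \<kappa>0: "0 \<le> \<kappa>" unfolding \<kappa>_def by (intro class_K_nonneg[OF K(2)] class_K_nonneg[OF K(4)] c)
    have \<beta>0: "0 \<le> \<beta> (\<psi>2 (norm x0)) t"
      by (intro class_KL_nonneg[OF \<beta>(1)] class_K_nonneg[OF K(2)] t) simp
    have \<psi>0: "0 \<le> \<psi>1 (norm (x t))" by (simp add: class_K_nonneg[OF class_K_inf_imp_K[OF \<psi>(1)]])
    have "norm (x t) = \<phi> (\<psi>1 (norm (x t)))" by (simp add: \<phi>(2))
    also have "\<dots> \<le> \<phi> (\<beta> (\<psi>2 (norm x0)) t) + \<phi> \<kappa>"
      using le class_K_mono[OF K(1) \<psi>0, of \<kappa>] class_K_mono[OF K(1) \<psi>0, of "\<beta> (\<psi>2 (norm x0)) t"]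
        class_K_nonneg[OF K(1) \<kappa>0] class_K_nonneg[OF K(1) \<beta>0] by linarith
    finally show ?thesis by (simp add: x(3) \<kappa>_def c_def)
  qed
  then show ?thesis
    unfolding ISS_def
    by (intro conjI bexI[OF _ \<Gamma>] bexI[OF _ B] allI ballI impI
        dissipates_imp_forward_complete[OF diss \<alpha> \<sigma>])
qed

end

theorem proposition1:
  fixes T :: "real \<Rightarrow> 'x \<Rightarrow>\<^sub>L 'x::banach"
    and D :: "'x set"
    and A :: "'x \<Rightarrow> 'x"
    and f :: "'x \<Rightarrow> 'u::banach \<Rightarrow> 'x"
  assumes "generates D A T"
    and "f 0 0 = 0"
    and "lipschitz_on_bounded_sets f"
    and "\<And>x. continuous_on UNIV (f x)"
  shows "((\<exists>V. iISS_Lyapunov_function T f V) \<longrightarrow> iISS T f) \<and>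
         ((\<exists>V. ISS_Lyapunov_function T f V) \<longrightarrow> ISS T f)"
proof -
  interpret semilinear_system T f
    using assms by unfold_locales (auto simp: generates_def)
  have "iISS T f" if "iISS_Lyapunov_function T f V" for V
    using that dissipates_imp_iISS unfolding iISS_Lyapunov_function_def by blast
  moreover have "ISS T f" if V: "ISS_Lyapunov_function T f V" for V
  proof -
    obtain \<alpha> \<sigma> where \<alpha>\<sigma>: "\<alpha> \<in> class_P" "\<sigma> \<in> class_K" "dissipates T f V \<alpha> \<sigma>"
      and lim: "filterlim \<alpha> at_top at_top \<or>
        Liminf at_top (\<lambda>\<tau>. ereal (\<alpha> \<tau>)) \<ge> Lim at_top (\<lambda>\<tau>. ereal (\<sigma> \<tau>))"
      using V unfolding ISS_Lyapunov_function_def by blast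
    have "eventually (\<lambda>r. \<sigma> c < \<alpha> r) at_top" if "0 \<le> c" for c
      using lim
    proof
      assume "filterlim \<alpha> at_top at_top"
      then show ?thesis by (simp add: filterlim_at_top_dense)
    qed (rule class_K_Liminf_ge_Lim_imp_eventually_greater[OF \<alpha>\<sigma>(2) that])
    then show ?thesis by (rule dissipates_imp_ISS[OF \<alpha>\<sigma>(3,1,2)])
  qed
  ultimately show ?thesis by blast
qed

end
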